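(* Let $F$ be an infinite field belonging to at least one of the following classes: (a) finitely generated fields; (b) discrete valued fields; (c) fields of Hahn series; (d) local fields; (e) global fields; (f) (algebraic) function fields. Then the multiplicative group $F^\times$ is not indecomposable, i.e. it is isomorphic to a direct sum of two nontrivial groups.
   Context: An abelian group is indecomposable if it is not isomorphic to a direct sum of two nontrivial groups; otherwise it is decomposable. An algebraic function field of $n$ variables over a field $k$ is a finite extension of the field $k(x_1, \dots, x_n)$ of rational functions in $n$ variables over $k$, where the set of variables is possibly empty. The finitely generated fields are those algebraic function fields for which $k = \mathbf{F}_p$ ($p$ prime) or $k = \mathbf{Q}$. Let $G$ be a linearly ordered abelian group (written additively) and $K$ a field. A valuation on $K$ with value group $G$ is a surjective group homomorphism $v : K^\times \to G$, extended to $K$ by $v(0) = \infty$ (with $\infty \geq g$ for all $g \in G$), such that $v(x+y) \geq \min\{v(x), v(y)\}$ for all $x, y \in K$. A valued field with value group $\mathbf{Z}$ is called a discrete valued field. For a field $K$ and an arbitrary linearly ordered abelian group $G$, the field of Hahn series $K((G))$ consists of formal sums $\sum_{g \in G} a_g x^g$ with $a_g \in K$ whose support $\{g \in G \mid a_g \neq 0\}$ is a well-ordered set, with the usual addition and multiplication of formal series. A local field is a field that is isomorphic as a topological field to $\mathbf{C}$, $\mathbf{R}$, a finite extension of the $p$-adic numbers $\mathbf{Q}_p$ ($p$ prime), or a field of formal Laurent series $\mathbf{F}_q((X))$ over a finite field $\mathbf{F}_q$. A global field is a number field (a finite extension of $\mathbf{Q}$) or a function field over a finite field (a finite extension of $\mathbf{F}_p(t)$,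 $p$ prime).
   Formalization: In (f) at least one variable is required and in (c) the exponent group G is nontrivial; otherwise these classes would contain every field, and some infinite fields of characteristic 2 have an indecomposable multiplicative group. *)

theory Defs
  imports
    "HOL-Analysis.Analysis"
    "HOL-Algebra.Algebra"
    "HOL-Algebra.Algebraic_Closure_Type"
    "HOL-Computational_Algebra.Computational_Algebra"
    "HOL-Library.Poly_Mapping"
    "HOL-Library.Lattice_Constructions"
begin

section \<open>Indecomposable groups\<close>

text \<open>
  The summands may be taken over the element type of the group itself: if the group is isomorphic
  to a direct product, each factor embeds into it.
\<close>
definition indecomposable :: "('a, 'm) monoid_scheme \<Rightarrow> bool" where
  "indecomposable A \<longleftrightarrow>
     \<not> (\<exists>(G :: 'a monoid) (H :: 'a monoid).
           group G \<and> group H \<and> carrier G \<noteq> {\<one>\<^bsub>G\<^esub>} \<and> carrier H \<noteq> {\<one>\<^bsub>H\<^esub>} \<and> A \<cong> G \<times>\<times> H)"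


section \<open>Finite extensions and function fields\<close>

text \<open>
  \<^term>\<open>F\<close> is regarded as an extension of \<^term>\<open>E\<close> along a homomorphism of fields, which is
  automatically injective.
\<close>
definition finite_extension :: "('e, 'n) ring_scheme \<Rightarrow> ('a, 'm) ring_scheme \<Rightarrow> bool" where
  "finite_extension E F \<longleftrightarrow> field E \<and> field F \<and>
     (\<exists>h \<in> ring_hom E F. ring.finite_dimension F (h ` carrier E) (carrier F))"

text \<open>
  A polynomial is a finitely supported map from monomials to coefficients, and a monomial is a
  finitely supported map from variables (numbered by \<^typ>\<open>nat\<close>) to exponents.
\<close>
definition polys_in :: "nat \<Rightarrow> ((nat \<Rightarrow>\<^sub>0 nat) \<Rightarrow>\<^sub>0 'k::field) set" where
  "polys_in n = {p. \<forall>m \<in> Poly_Mapping.keys p. Poly_Mapping.keys m \<subseteq> {..<n}}"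

definition rational_functions :: "nat \<Rightarrow> ((nat \<Rightarrow>\<^sub>0 nat) \<Rightarrow>\<^sub>0 'k::field) fract ring" where
  "rational_functions n =
     (ring_of_type_algebra :: ((nat \<Rightarrow>\<^sub>0 nat) \<Rightarrow>\<^sub>0 'k) fract ring)
       \<lparr>carrier := {Fract p q |p q. p \<in> polys_in n \<and> q \<in> polys_in n \<and> q \<noteq> 0}\<rparr>"

text \<open>Algebraic function fields of \<^term>\<open>n\<close> variables over the field \<^typ>\<open>'k::field\<close>.\<close>
definition algebraic_function_field ::
    "nat \<Rightarrow> 'k::field itself \<Rightarrow> ('a, 'm) ring_scheme \<Rightarrow> bool" where
  "algebraic_function_field n k F \<longleftrightarrow>
     finite_extension (rational_functions n :: ((nat \<Rightarrow>\<^sub>0 nat) \<Rightarrow>\<^sub>0 'k) fract ring) F"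

text \<open>
  Over an arbitrary field of constants at least one variable is required. With \<open>n = 0\<close> allowed,
  every field would be a function field, being a finite extension of itself.
\<close>
definition function_field :: "'k::field itself \<Rightarrow> ('a, 'm) ring_scheme \<Rightarrow> bool" where
  "function_field k F \<longleftrightarrow> (\<exists>n \<ge> 1. algebraic_function_field n k F)"

text \<open>
  The prime fields of positive characteristic are represented by types \<^typ>\<open>'p::field\<close> with a prime
  number of elements; as \<^typ>\<open>'p::field\<close> varies these are, up to isomorphism, all of them.
\<close>
definition finitely_generated_field :: "'p::field itself \<Rightarrow> ('a, 'm) ring_scheme \<Rightarrow> bool" where
  "finitely_generated_field P F \<longleftrightarrow>
     (\<exists>n. (Factorial_Ring.prime CARD('p) \<and> algebraic_function_field n P F) \<or>
          algebraic_function_field n TYPE(rat) F)"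

definition global_field :: "'p::field itself \<Rightarrow> ('a, 'm) ring_scheme \<Rightarrow> bool" where
  "global_field P F \<longleftrightarrow>
     finite_extension (ring_of_type_algebra :: rat ring) F \<or>
     (Factorial_Ring.prime CARD('p) \<and> algebraic_function_field 1 P F)"


section \<open>Valued fields\<close>

definition additive_group :: "'g::ab_group_add monoid" where
  "additive_group = \<lparr>carrier = UNIV, monoid.mult = (+), one = 0\<rparr>"

text \<open>The extension of a map on nonzero elements by the value infinity, here \<^const>\<open>top.Top\<close>, at zero.\<close>
definition val_ext :: "('a, 'm) ring_scheme \<Rightarrow> ('a \<Rightarrow> 'g) \<Rightarrow> 'a \<Rightarrow> 'g top" where
  "val_ext K v x = (if x = \<zero>\<^bsub>K\<^esub> then top.Top else top.Value (v x))"

definition valuation ::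
    "('a, 'm) ring_scheme \<Rightarrow> ('a \<Rightarrow> 'g::linordered_ab_group_add) \<Rightarrow> bool" where
  "valuation K v \<longleftrightarrow>
     v \<in> hom (Multiplicative_Group.mult_of K) (additive_group :: 'g monoid) \<and>
     v ` carrier (Multiplicative_Group.mult_of K) = UNIV \<and>
     (\<forall>x \<in> carrier K. \<forall>y \<in> carrier K.
        val_ext K v (x \<oplus>\<^bsub>K\<^esub> y) \<ge> min (val_ext K v x) (val_ext K v y))"

definition discrete_valued_field :: "('a, 'm) ring_scheme \<Rightarrow> bool" where
  "discrete_valued_field K \<longleftrightarrow> field K \<and> (\<exists>v :: 'a \<Rightarrow> int. valuation K v)"


section \<open>Hahn series\<close>

definition well_ordered_set :: "'g::linorder set \<Rightarrow> bool" where
  "well_ordered_set A \<longleftrightarrow> well_order_on A {(x, y). x \<in> A \<and> y \<in> A \<and> x \<le> y}"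

text \<open>
  In the product, the index set of the sum is finite because the supports are well-ordered.
\<close>
definition hahn_series :: "('g::linordered_ab_group_add \<Rightarrow> 'k::field) ring" where
  "hahn_series =
     \<lparr>carrier = {f. well_ordered_set {g. f g \<noteq> 0}},
      monoid.mult = (\<lambda>f h g. \<Sum>a \<in> {a. f a \<noteq> 0 \<and> h (g - a) \<noteq> 0}. f a * h (g - a)),
      one = (\<lambda>g. if g = 0 then 1 else 0),
      ring.zero = (\<lambda>g. 0),
      add = (\<lambda>f h g. f g + h g)\<rparr>"

text \<open>
  The exponent group is required to be nontrivial. For the trivial group the Hahn series over a
  field are that field again, so that every field would be a field of Hahn series.
\<close>
definition hahn_series_field ::
    "'k::field itself \<Rightarrow> 'g::linordered_ab_group_add itself \<Rightarrow> ('a, 'm) ring_scheme \<Rightarrow> bool" where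
  "hahn_series_field k G F \<longleftrightarrow>
     (\<exists>g :: 'g. g \<noteq> 0) \<and> F \<simeq> (hahn_series :: ('g \<Rightarrow> 'k) ring)"


section \<open>The p-adic numbers\<close>

definition padic_norm :: "nat \<Rightarrow> rat \<Rightarrow> real" where
  "padic_norm p x =
     (if x = 0 then 0
      else real p powi (int (Factorial_Ring.multiplicity (int p) (snd (quotient_of x)))
                        - int (Factorial_Ring.multiplicity (int p) (fst (quotient_of x)))))"

definition padic_cauchy :: "nat \<Rightarrow> (nat \<Rightarrow> rat) \<Rightarrow> bool" where
  "padic_cauchy p a \<longleftrightarrow> (\<forall>\<epsilon>>0. \<exists>N. \<forall>m\<ge>N. \<forall>n\<ge>N. padic_norm p (a m - a n) < \<epsilon>)"

definition padic_cauchy_ring :: "nat \<Rightarrow> (nat \<Rightarrow> rat) ring" where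
  "padic_cauchy_ring p =
     \<lparr>carrier = {a. padic_cauchy p a},
      monoid.mult = (\<lambda>a b n. a n * b n), one = (\<lambda>n. 1),
      ring.zero = (\<lambda>n. 0), add = (\<lambda>a b n. a n + b n)\<rparr>"

definition padic_null :: "nat \<Rightarrow> (nat \<Rightarrow> rat) set" where
  "padic_null p = {a. (\<lambda>n. padic_norm p (a n)) \<longlonglongrightarrow> 0}"

definition padic_field :: "nat \<Rightarrow> (nat \<Rightarrow> rat) set ring" where
  "padic_field p = padic_cauchy_ring p Quot padic_null p"

text \<open>The limit does not depend on the chosen representatives.\<close>
definition padic_dist :: "nat \<Rightarrow> (nat \<Rightarrow> rat) set \<Rightarrow> (nat \<Rightarrow> rat) set \<Rightarrow> real" where
  "padic_dist p A B = lim (\<lambda>n. padic_norm p ((SOME a. a \<in> A) n - (SOME b. b \<in> B) n))"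

definition padic_topology :: "nat \<Rightarrow> (nat \<Rightarrow> rat) set topology" where
  "padic_topology p = Metric_space.mtopology (carrier (padic_field p)) (padic_dist p)"


section \<open>Local fields\<close>

definition topological_field_iso ::
    "('a, 'm) ring_scheme \<Rightarrow> 'a topology \<Rightarrow> ('b, 'n) ring_scheme \<Rightarrow> 'b topology \<Rightarrow> bool" where
  "topological_field_iso F T E S \<longleftrightarrow> (\<exists>h \<in> ring_iso F E. homeomorphic_map T S h)"

text \<open>
  \<^term>\<open>(F, T)\<close> is a finite extension of \<^term>\<open>(E, S)\<close> with its canonical topology, namely the
  product topology obtained from the coordinates with respect to a basis.
\<close>
definition topological_finite_extension ::
    "('e, 'n) ring_scheme \<Rightarrow> 'e topology \<Rightarrow> ('a, 'm) ring_scheme \<Rightarrow> 'a topology \<Rightarrow> bool" where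
  "topological_finite_extension E S F T \<longleftrightarrow> field E \<and> field F \<and>
     (\<exists>h \<in> ring_hom E F. ring.finite_dimension F (h ` carrier E) (carrier F) \<and>
       (\<exists>n. \<exists>b \<in> {..<n::nat} \<rightarrow> carrier F. topspace T = carrier F \<and>
          homeomorphic_map (product_topology (\<lambda>i. S) {..<n}) T
            (\<lambda>a. \<Oplus>\<^bsub>F\<^esub>i\<in>{..<n}. h (a i) \<otimes>\<^bsub>F\<^esub> b i)))"

text \<open>
  The notion of finite extension used here is invariant under isomorphism of topological fields.
  Finite fields are represented by types \<^typ>\<open>'q::{field,finite}\<close>, and formal Laurent series carry
  the topology of the library metric, which is the usual one.
\<close>
definition local_topological_field ::
    "'q::{field,finite} itself \<Rightarrow> ('a, 'm) ring_scheme \<Rightarrow> 'a topology \<Rightarrow> bool" where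
  "local_topological_field q F T \<longleftrightarrow> field F \<and> topspace T = carrier F \<and>
     (topological_field_iso F T (ring_of_type_algebra :: complex ring) euclidean \<or>
      topological_field_iso F T (ring_of_type_algebra :: real ring) euclidean \<or>
      (\<exists>p. Factorial_Ring.prime p \<and> topological_finite_extension (padic_field p) (padic_topology p) F T) \<or>
      topological_field_iso F T (ring_of_type_algebra :: 'q fls ring) euclidean)"

definition local_field :: "'q::{field,finite} itself \<Rightarrow> ('a, 'm) ring_scheme \<Rightarrow> bool" where
  "local_field q F \<longleftrightarrow> (\<exists>T. local_topological_field q F T)"

end

theory Submission
  imports Defs "HOL-Library.Function_Algebras" "Jordan_Normal_Form.Determinant"
begin

text \<open>
  An abelian group with an endomorphism \<open>e\<close> satisfying \<open>e \<circ> e = e\<close> is the direct product of the image and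
  the kernel of \<open>e\<close>, so each class of fields only needs an idempotent endomorphism of \<open>F\<^sup>\<times>\<close> that
  is neither trivial nor the identity (\<open>idempotent_endomorphism_decomposes\<close>).

  For the real and the complex numbers the absolute value is such an endomorphism, and for Hahn series
  it is the map that sends a series to the monomial \<open>x\<^sup>g\<close> with \<open>g\<close> the least exponent
  of its support.

  In all other cases there is a nonzero homomorphism \<open>\<phi> : F\<^sup>\<times> \<rightarrow> \<int>\<close>. Its image is
  infinite cyclic, so some \<open>t\<close> maps to a generator and \<open>x \<mapsto> t [^] \<phi> x\<close>, with
  \<open>\<phi>\<close> normalised to be surjective, is idempotent. It is not the identity, because the multiplicative group
  of a field is never infinite cyclic (\<open>field_units_not_generated_by_one\<close>): in characteristic other than two
  it contains the torsion element \<open>-1\<close>, and in characteristic two the Frobenius map would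
  turn the equation expressing \<open>1 + t\<close> as a power of the generator \<open>t\<close> into a square root
  of \<open>t\<close>.

  For discrete valued fields and Laurent series \<open>\<phi>\<close> is the valuation. The remaining fields
  are finite extensions of a field \<open>E\<close> with an evident nonzero homomorphism
  \<open>\<nu> : E\<^sup>\<times> \<rightarrow> \<int>\<close>: a \<open>p\<close>-adic valuation on the rational or the \<open>p\<close>-adic numbers, and on
  rational functions the exponent of a variable in the leading monomial or, over the rational numbers, the
  valuation of the leading coefficient. The composition of the norm \<open>N : F\<^sup>\<times> \<rightarrow> E\<^sup>\<times>\<close> with \<open>\<nu>\<close> is a homomorphism, and it is not zero since
  \<open>N c = c\<^sup>n\<close> for \<open>c\<close> in \<open>E\<close>, where \<open>n\<close> is the degree of the extension
  (\<open>decomposable_by_hom_on_subfield\<close>).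

  This leaves the finitely generated fields in no variables over a prime field of positive characteristic,
  which are finite.
\<close>


section \<open>Splitting off a direct factor\<close>

text \<open>
  The isomorphism is \<open>x \<mapsto> (e x, x (e x)\<^sup>-\<^sup>1)\<close>; its inverse is multiplication.
\<close>
lemma idempotent_endomorphism_decomposes:
  fixes A :: "'a monoid"
  assumes "comm_group A" and e: "e \<in> hom A A"
    and idem: "\<And>x. x \<in> carrier A \<Longrightarrow> e (e x) = e x"
    and "a \<in> carrier A" "e a \<noteq> \<one>\<^bsub>A\<^esub>"
    and "b \<in> carrier A" "e b \<noteq> b"
  shows "\<not> indecomposable A"
proof -
  interpret A: comm_group A by fact
  interpret e: group_hom A A e
    by (intro group_hom.intro group_hom_axioms.intro A.is_group e)
  define G where "G = A\<lparr>carrier := e ` carrier A\<rparr>"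
  define H where "H = A\<lparr>carrier := kernel A A e\<rparr>"
  have ker: "x \<otimes>\<^bsub>A\<^esub> inv\<^bsub>A\<^esub> (e x) \<in> kernel A A e" if "x \<in> carrier A" for x
    using that by (simp add: kernel_def idem)
  have "group G" "group H"
    unfolding G_def H_def
    by (auto intro!: subgroup.subgroup_is_group e.img_is_subgroup e.subgroup_kernel A.is_group)
  moreover have "carrier G \<noteq> {\<one>\<^bsub>G\<^esub>}"
    using assms(4,5) by (auto simp: G_def)
  moreover have "carrier H \<noteq> {\<one>\<^bsub>H\<^esub>}"
  proof -
    have "b \<otimes>\<^bsub>A\<^esub> inv\<^bsub>A\<^esub> (e b) \<noteq> \<one>\<^bsub>A\<^esub>"
      using assms(6,7) by (metis A.inv_closed A.inv_equality A.inv_inv e.hom_closed)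
    then show ?thesis
      using ker[OF assms(6)] by (auto simp: H_def)
  qed
  moreover have "(\<lambda>x. (e x, x \<otimes>\<^bsub>A\<^esub> inv\<^bsub>A\<^esub> (e x))) \<in> iso A (G \<times>\<times> H)"
  proof (rule isoI)
    show "(\<lambda>x. (e x, x \<otimes>\<^bsub>A\<^esub> inv\<^bsub>A\<^esub> (e x))) \<in> hom A (G \<times>\<times> H)"
      using ker by (auto intro!: homI simp: G_def H_def DirProd_def A.inv_mult_group A.m_ac)
    show "bij_betw (\<lambda>x. (e x, x \<otimes>\<^bsub>A\<^esub> inv\<^bsub>A\<^esub> (e x))) (carrier A) (carrier (G \<times>\<times> H))"
    proof (rule bij_betw_byWitness[where f' = "\<lambda>(g, h). g \<otimes>\<^bsub>A\<^esub> h"])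
      show "\<forall>x\<in>carrier A. (\<lambda>(g, h). g \<otimes>\<^bsub>A\<^esub> h) (e x, x \<otimes>\<^bsub>A\<^esub> inv\<^bsub>A\<^esub> (e x)) = x"
        by (auto simp: A.m_lcomm)
      show "\<forall>p\<in>carrier (G \<times>\<times> H). (\<lambda>x. (e x, x \<otimes>\<^bsub>A\<^esub> inv\<^bsub>A\<^esub> (e x)))
                ((\<lambda>(g, h). g \<otimes>\<^bsub>A\<^esub> h) p) = p"
        by (auto simp: G_def H_def kernel_def idem A.m_ac)
      show "(\<lambda>x. (e x, x \<otimes>\<^bsub>A\<^esub> inv\<^bsub>A\<^esub> (e x))) ` carrier A \<subseteq> carrier (G \<times>\<times> H)"
        using ker by (auto simp: G_def H_def)
      show "(\<lambda>(g, h). g \<otimes>\<^bsub>A\<^esub> h) ` carrier (G \<times>\<times> H) \<subseteq> carrier A"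
        by (auto simp: G_def H_def kernel_def)
    qed
  qed
  ultimately show ?thesis
    unfolding indecomposable_def is_iso_def by blast
qed

lemma mult_of_comm_group:
  assumes "field F" shows "comm_group (Multiplicative_Group.mult_of F)"
proof -
  interpret field F by fact
  interpret M: group "Multiplicative_Group.mult_of F" by (rule field_mult_group)
  show ?thesis
    by (rule M.group_comm_groupI) (auto simp: m_comm)
qed

text \<open>
  The condition on \<open>h \<zero>\<close> stands in for the ring axioms of \<open>E\<close>, whose direct verification
  for Hahn series would be laborious.
\<close>
lemma decomposable_by_iso_idempotent:
  fixes F :: "('a, 'm) ring_scheme" and E :: "('b, 'n) ring_scheme"
  assumes "field F" and h: "h \<in> ring_iso F E"
    and closed: "\<And>x. x \<in> carrier E - {\<zero>\<^bsub>E\<^esub>} \<Longrightarrow> e x \<in> carrier E - {\<zero>\<^bsub>E\<^esub>}"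
    and mult: "\<And>x y. x \<in> carrier E - {\<zero>\<^bsub>E\<^esub>} \<Longrightarrow> y \<in> carrier E - {\<zero>\<^bsub>E\<^esub>} \<Longrightarrow>
                 e (x \<otimes>\<^bsub>E\<^esub> y) = e x \<otimes>\<^bsub>E\<^esub> e y"
    and idem: "\<And>x. x \<in> carrier E - {\<zero>\<^bsub>E\<^esub>} \<Longrightarrow> e (e x) = e x"
    and a: "a \<in> carrier E - {\<zero>\<^bsub>E\<^esub>}" "e a \<noteq> \<one>\<^bsub>E\<^esub>"
    and b: "b \<in> carrier E - {\<zero>\<^bsub>E\<^esub>}" "e b \<noteq> b"
    and zero: "h \<zero>\<^bsub>F\<^esub> = \<zero>\<^bsub>E\<^esub>"
  shows "\<not> indecomposable (Multiplicative_Group.mult_of F)"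
proof -
  interpret F: field F by fact
  have hm: "h \<in> Ring.ring_hom F E" and bij: "bij_betw h (carrier F) (carrier E)"
    using h by (auto simp: ring_iso_def)
  define k where "k = inv_into (carrier F) h"
  have hk: "h (k y) = y" "k y \<in> carrier F" if "y \<in> carrier E" for y
    using bij that by (auto simp: k_def bij_betw_def f_inv_into_f inv_into_into)
  have kh: "k (h x) = x" if "x \<in> carrier F" for x
    using bij that by (auto simp: k_def bij_betw_def inv_into_f_f)
  have hF: "h x \<in> carrier E - {\<zero>\<^bsub>E\<^esub>}" if "x \<in> carrier F - {\<zero>\<^bsub>F\<^esub>}" for x
    using that kh F.zero_closed zero bij by (metis DiffD1 DiffD2 DiffI bij_betwE singletonI singletonD)
  have kE: "k y \<in> carrier F - {\<zero>\<^bsub>F\<^esub>}" if "y \<in> carrier E - {\<zero>\<^bsub>E\<^esub>}" for y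
    using that hk zero by (metis DiffD1 DiffD2 DiffI singletonI singletonD)
  have kmult: "k (x \<otimes>\<^bsub>E\<^esub> y) = k x \<otimes>\<^bsub>F\<^esub> k y" if "x \<in> carrier E" "y \<in> carrier E" for x y
    using that hk kh ring_hom_mult[OF hm, of "k x" "k y"] by (metis F.m_closed)
  show ?thesis
  proof (rule idempotent_endomorphism_decomposes[where e = "\<lambda>x. k (e (h x))" and a = "k a" and b = "k b"])
    show "comm_group (Multiplicative_Group.mult_of F)"
      using assms(1) by (rule mult_of_comm_group)
    show "(\<lambda>x. k (e (h x))) \<in> hom (Multiplicative_Group.mult_of F) (Multiplicative_Group.mult_of F)"
    proof (rule homI)
      fix x assume "x \<in> carrier (Multiplicative_Group.mult_of F)"
      then show "k (e (h x)) \<in> carrier (Multiplicative_Group.mult_of F)"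
        using kE[OF closed[OF hF]] by simp
    next
      fix x y
      assume "x \<in> carrier (Multiplicative_Group.mult_of F)" "y \<in> carrier (Multiplicative_Group.mult_of F)"
      then show "k (e (h (x \<otimes>\<^bsub>Multiplicative_Group.mult_of F\<^esub> y)))
        = k (e (h x)) \<otimes>\<^bsub>Multiplicative_Group.mult_of F\<^esub> k (e (h y))"
        using hF[of x] hF[of y] closed[of "h x"] closed[of "h y"]
        by (simp add: ring_hom_mult[OF hm] mult kmult)
    qed
    show "k (e (h (k (e (h x))))) = k (e (h x))" if "x \<in> carrier (Multiplicative_Group.mult_of F)" for x
      using that hF[of x] closed[of "h x"] by (simp add: hk idem)
    show "k a \<in> carrier (Multiplicative_Group.mult_of F)" "k b \<in> carrier (Multiplicative_Group.mult_of F)"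
      using kE a b by simp_all
    show "k (e (h (k a))) \<noteq> \<one>\<^bsub>Multiplicative_Group.mult_of F\<^esub>"
      using a hk[of a] hk[of "e a"] closed[of a] ring_hom_one[OF hm] by auto
    show "k (e (h (k b))) \<noteq> k b"
      using b hk[of b] hk[of "e b"] closed[of b] by auto
  qed
qed

lemma int_valued_hom_int_pow:
  fixes F :: "('a, 'm) ring_scheme" (structure) and \<phi> :: "'a \<Rightarrow> int"
  assumes "field F"
    and add: "\<And>x y. x \<in> carrier F - {\<zero>} \<Longrightarrow> y \<in> carrier F - {\<zero>} \<Longrightarrow> \<phi> (x \<otimes> y) = \<phi> x + \<phi> y"
    and t: "t \<in> carrier F - {\<zero>}"
  shows "\<phi> (t [^]\<^bsub>Multiplicative_Group.mult_of F\<^esub> (k::int)) = k * \<phi> t"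
proof -
  interpret field F by fact
  interpret h: group_hom "Multiplicative_Group.mult_of F" integer_group \<phi>
    using add by (intro group_hom.intro group_hom_axioms.intro field_mult_group homI
      group_integer_group) (auto simp: integer_group_def)
  show ?thesis using h.hom_int_pow[of t k] t by simp
qed

text \<open>
  Suppose that every nonzero element is a power of \<open>t\<close>. Since \<open>\<phi> (-1) = 0\<close>, this forces
  \<open>-1 = 1\<close>, so squaring is additive. Then \<open>1 + t = t [^] k\<close> makes \<open>t\<close> a square: for
  \<open>k = 2 m\<close> and \<open>s = t [^] m\<close> it reads \<open>t = (1 + s)\<^sup>2\<close>, and for \<open>k = 2 m + 1\<close> it
  reads \<open>1 = t (1 + s)\<^sup>2\<close>. A square root \<open>t [^] j\<close> of \<open>t\<close> would satisfy
  \<open>2 j = 1\<close>.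
\<close>
lemma field_units_not_generated_by_one:
  fixes F :: "('a, 'm) ring_scheme" (structure) and \<phi> :: "'a \<Rightarrow> int"
  assumes "field F"
    and add: "\<And>x y. x \<in> carrier F - {\<zero>} \<Longrightarrow> y \<in> carrier F - {\<zero>} \<Longrightarrow>
                \<phi> (x \<otimes> y) = \<phi> x + \<phi> y"
    and t: "t \<in> carrier F - {\<zero>}" "\<phi> t \<noteq> 0"
  shows "\<exists>x \<in> carrier F - {\<zero>}. \<forall>k::int. x \<noteq> t [^]\<^bsub>Multiplicative_Group.mult_of F\<^esub> k"
proof (rule ccontr)
  interpret field F by fact
  interpret M: comm_group "Multiplicative_Group.mult_of F" using assms(1) by (rule mult_of_comm_group)
  note [simp] = m_ac a_ac l_distr r_distr
  let ?pow = "\<lambda>k::int. t [^]\<^bsub>Multiplicative_Group.mult_of F\<^esub> k"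
  assume neg: "\<not> ?thesis"
  then have gen: "\<exists>k. x = ?pow k" if "x \<in> carrier F - {\<zero>}" for x using that by blast
  have pow: "\<phi> (?pow k) = k * \<phi> t" for k
    using assms(1) add t(1) by (rule int_valued_hom_int_pow)
  have inj: "x = \<one>" if "x \<in> carrier F - {\<zero>}" "\<phi> x = 0" for x
    using gen[OF that(1)] pow t(2) that(2) by auto
  have tc: "t \<in> carrier F" using t by simp
  have pc: "?pow k \<in> carrier F" "?pow k \<noteq> \<zero>" for k using M.int_pow_closed[of t k] t by auto
  have phi1: "\<phi> \<one> = 0" using add[of \<one> \<one>] by simp
  have m1: "\<ominus> \<one> \<in> carrier F - {\<zero>}" by (simp add: local.add.inv_eq_1_iff)
  have "\<phi> (\<ominus> \<one> \<otimes> \<ominus> \<one>) = 0" using phi1 by (simp add: l_minus)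
  then have "\<phi> (\<ominus> \<one>) = 0" using add[OF m1 m1] by simp
  then have "\<ominus> \<one> = \<one>" using inj m1 by blast
  then have two: "\<one> \<oplus> \<one> = \<zero>" by (metis one_closed r_neg)
  have two': "x \<oplus> x = \<zero>" if "x \<in> carrier F" for x
    using two l_distr[of \<one> \<one> x] that by simp
  have two'': "x \<oplus> (x \<oplus> y) = y" if "x \<in> carrier F" "y \<in> carrier F" for x y
    using two'[OF that(1)] that by (metis a_assoc l_zero)
  have sq: "(\<one> \<oplus> x) \<otimes> (\<one> \<oplus> x) = \<one> \<oplus> x \<otimes> x" if "x \<in> carrier F" for x
    using that by (simp add: two'')
  have not_sq: False if "s \<in> carrier F" "t = s \<otimes> s" for s
  proof -
    have s: "s \<in> carrier F - {\<zero>}" using that t by auto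
    then have "\<phi> t = \<phi> s + \<phi> s" using that add by auto
    moreover obtain k where "s = ?pow k" using gen[OF s] by blast
    ultimately have "(2 * k - 1) * \<phi> t = 0" using pow[of k] by (simp add: algebra_simps)
    then have "2 * k = 1" using t(2) by simp
    then show False by presburger
  qed
  have "\<one> \<oplus> t \<noteq> \<zero>"
  proof
    assume "\<one> \<oplus> t = \<zero>"
    then have "t = \<one>" using two two'' tc by (metis one_closed r_zero)
    then show False using phi1 t by simp
  qed
  then obtain k where k: "\<one> \<oplus> t = ?pow k" using gen[of "\<one> \<oplus> t"] t by auto
  define s where "s = ?pow (k div 2)"
  have s: "s \<in> carrier F" "s \<noteq> \<zero>" using pc by (auto simp: s_def)
  show False
  proof (cases "even k")
    case True
    then have "k = k div 2 + k div 2" by simp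
    then have "\<one> \<oplus> t = s \<otimes> s"
      unfolding k s_def using M.int_pow_mult[of t "k div 2" "k div 2"] t by simp
    then have "t = \<one> \<oplus> s \<otimes> s" by (metis two'' tc one_closed)
    then show False using sq s not_sq[of "\<one> \<oplus> s"] by simp
  next
    case False
    then have "k = 1 + (k div 2 + k div 2)" by presburger
    then have "\<one> \<oplus> t = t \<otimes> (s \<otimes> s)"
      unfolding k s_def using M.int_pow_mult[of t "k div 2" "k div 2"] M.int_pow_mult[of t 1 "k div 2 + k div 2"] t
      by (simp del: m_ac)
    then have "\<one> = t \<oplus> t \<otimes> (s \<otimes> s)" using two''[of t \<one>] tc s by simp
    also have "\<dots> = t \<otimes> ((\<one> \<oplus> s) \<otimes> (\<one> \<oplus> s))" 
      using sq[of s] s tc by (simp del: m_ac)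
    finally have eq: "\<one> = t \<otimes> ((\<one> \<oplus> s) \<otimes> (\<one> \<oplus> s))" .
    let ?u = "\<one> \<oplus> s"
    have u: "?u \<in> carrier F - {\<zero>}" using eq s tc by (metis DiffI a_closed one_closed r_null singletonD zero_not_one)
    have "t = t \<otimes> t \<otimes> ?u \<otimes> ?u" using eq u tc 
      by (metis DiffD1 m_assoc m_closed r_one)
    then show False using not_sq[of "t \<otimes> ?u"] u tc by (metis DiffD1 m_assoc m_closed m_comm)
  qed
qed

text \<open>
  The image of \<open>\<phi>\<close> is generated by its least positive element \<open>\<phi> t\<close>, and
  \<open>\<phi> t \<mapsto> t\<close> is a section of \<open>\<phi>\<close> on it. The composition of \<open>\<phi>\<close> with this
  section is idempotent.
\<close>
lemma decomposable_by_int_valued_hom: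
  fixes F :: "('a, 'm) ring_scheme" (structure) and \<phi> :: "'a \<Rightarrow> int"
  assumes "field F"
    and add: "\<And>x y. x \<in> carrier F - {\<zero>} \<Longrightarrow> y \<in> carrier F - {\<zero>} \<Longrightarrow> \<phi> (x \<otimes> y) = \<phi> x + \<phi> y"
    and s: "s \<in> carrier F - {\<zero>}" "\<phi> s \<noteq> 0"
  shows "\<not> indecomposable (Multiplicative_Group.mult_of F)"
proof -
  interpret field F by fact
  interpret M: comm_group "Multiplicative_Group.mult_of F" using assms(1) by (rule mult_of_comm_group)
  let ?M = "Multiplicative_Group.mult_of F"
  have pow: "\<phi> (x [^]\<^bsub>?M\<^esub> k) = k * \<phi> x" if "x \<in> carrier F - {\<zero>}" for x and k :: int
    using assms(1) add that by (rule int_valued_hom_int_pow)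
  have pc: "x [^]\<^bsub>?M\<^esub> (k::int) \<in> carrier F - {\<zero>}" if "x \<in> carrier F - {\<zero>}" for x k
    using M.int_pow_closed[of x k] that by auto
  define P where "P n \<longleftrightarrow> n > 0 \<and> (\<exists>x \<in> carrier F - {\<zero>}. \<phi> x = int n)" for n
  have "P (nat \<bar>\<phi> s\<bar>)"
    unfolding P_def
  proof (intro conjI bexI)
    show "\<phi> (s [^]\<^bsub>?M\<^esub> sgn (\<phi> s)) = int (nat \<bar>\<phi> s\<bar>)"
      using pow[OF s(1), of "sgn (\<phi> s)"] by (simp only: sgn_if) auto
  qed (use s pc in auto)
  then have "P (LEAST n. P n)" by (rule LeastI)
  then obtain t where t': "t \<in> carrier F - {\<zero>}" "\<phi> t = int (LEAST n. P n)" "(LEAST n. P n) > 0"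
    unfolding P_def[of "LEAST n. P n"] by blast
  then have t: "t \<in> carrier F - {\<zero>}" "\<phi> t > 0" "nat (\<phi> t) = (LEAST n. P n)"
    by simp_all
  have dvd: "\<phi> t dvd \<phi> x" if x: "x \<in> carrier F - {\<zero>}" for x
  proof (rule ccontr)
    assume "\<not> \<phi> t dvd \<phi> x"
    then have r: "0 < \<phi> x mod \<phi> t" "\<phi> x mod \<phi> t < \<phi> t"
      using t by (auto simp: dvd_eq_mod_eq_0 order.not_eq_order_implies_strict)
    let ?y = "x \<otimes> t [^]\<^bsub>?M\<^esub> (- (\<phi> x div \<phi> t))"
    have "\<phi> ?y = \<phi> x mod \<phi> t"
      using add[OF x pc[OF t(1)]] pow[OF t(1)] by (simp add: minus_div_mult_eq_mod[symmetric])
    moreover have "?y \<in> carrier F - {\<zero>}"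
      using x pc[OF t(1)] by (simp add: integral_iff)
    ultimately have "P (nat (\<phi> x mod \<phi> t))"
      using r unfolding P_def by (intro conjI bexI[of _ ?y]) auto
    then have "nat (\<phi> t) \<le> nat (\<phi> x mod \<phi> t)" using t(3) by (simp add: Least_le)
    then show False using r by simp
  qed
  have t0: "\<phi> t \<noteq> 0" using t(2) by simp
  obtain b where b: "b \<in> carrier F - {\<zero>}" "\<And>k::int. b \<noteq> t [^]\<^bsub>?M\<^esub> k"
    using field_units_not_generated_by_one[where \<phi> = \<phi>, OF assms(1) add t(1) t0] by auto
  show ?thesis
  proof (rule idempotent_endomorphism_decomposes[where e = "\<lambda>x. t [^]\<^bsub>?M\<^esub> (\<phi> x div \<phi> t)" and a = t and b = b])
    show "comm_group ?M" by (rule M.comm_group_axioms)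
    show "(\<lambda>x. t [^]\<^bsub>?M\<^esub> (\<phi> x div \<phi> t)) \<in> hom ?M ?M"
    proof (rule homI)
      fix x y assume "x \<in> carrier ?M" "y \<in> carrier ?M"
      then show "t [^]\<^bsub>?M\<^esub> (\<phi> (x \<otimes>\<^bsub>?M\<^esub> y) div \<phi> t) =
          t [^]\<^bsub>?M\<^esub> (\<phi> x div \<phi> t) \<otimes>\<^bsub>?M\<^esub> t [^]\<^bsub>?M\<^esub> (\<phi> y div \<phi> t)"
        using dvd[of x] t(1) add[of x y] M.int_pow_mult[of t "\<phi> x div \<phi> t" "\<phi> y div \<phi> t"]
        by (simp add: div_plus_div_distrib_dvd_left)
    qed (use pc[OF t(1)] in auto)
    show "t [^]\<^bsub>?M\<^esub> (\<phi> (t [^]\<^bsub>?M\<^esub> (\<phi> x div \<phi> t)) div \<phi> t) = t [^]\<^bsub>?M\<^esub> (\<phi> x div \<phi> t)" for x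
      using t by (simp add: pow)
    have "\<phi> \<one> = 0" using add[of \<one> \<one>] by simp
    then show "t [^]\<^bsub>?M\<^esub> (\<phi> t div \<phi> t) \<noteq> \<one>\<^bsub>?M\<^esub>" using t by auto
    show "t [^]\<^bsub>?M\<^esub> (\<phi> b div \<phi> t) \<noteq> b" using b(2) by (rule not_sym)
  qed (use t b in auto)
qed


section \<open>The norm along a finite extension\<close>

lemma (in ring) combine_eq_finsum:
  "length Ks = length Us \<Longrightarrow> set Ks \<subseteq> carrier R \<Longrightarrow> set Us \<subseteq> carrier R \<Longrightarrow>
     combine Ks Us = (\<Oplus>i\<in>{..<length Us}. Ks ! i \<otimes> Us ! i)"
proof (induction Ks Us rule: list_induct2)
  case Nil
  then show ?case by simp
next
  case (Cons k Ks u Us)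
  let ?f = "\<lambda>i. (k # Ks) ! i \<otimes> (u # Us) ! i"
  have "?f \<in> {..<Suc (length Us)} \<rightarrow> carrier R"
  proof
    fix i assume "i \<in> {..<Suc (length Us)}"
    then have "i < length (k # Ks)" "i < length (u # Us)" using Cons.hyps by auto
    then have "(k # Ks) ! i \<in> carrier R" "(u # Us) ! i \<in> carrier R"
      using Cons.prems nth_mem by blast+
    then show "?f i \<in> carrier R" by (rule m_closed)
  qed
  then have f: "?f 0 \<in> carrier R" "?f \<in> Suc ` {..<length Us} \<rightarrow> carrier R"
    by (blast intro: lessThan_iff[THEN iffD2] zero_less_Suc Suc_mono)+
  have "(\<Oplus>i\<in>{..<Suc (length Us)}. ?f i) = ?f 0 \<oplus> (\<Oplus>i\<in>Suc ` {..<length Us}. ?f i)"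
    unfolding lessThan_Suc_eq_insert_0 using f by (subst finsum_insert) auto
  also have "(\<Oplus>i\<in>Suc ` {..<length Us}. ?f i) = (\<Oplus>i\<in>{..<length Us}. ?f (Suc i))"
    using f(2) by (rule finsum_reindex) simp
  finally show ?case using Cons by simp
qed

lemma (in ring) finsum_swap:
  assumes "finite A" "finite B" and "\<And>i j. i \<in> A \<Longrightarrow> j \<in> B \<Longrightarrow> f i j \<in> carrier R"
  shows "(\<Oplus>i\<in>A. \<Oplus>j\<in>B. f i j) = (\<Oplus>j\<in>B. \<Oplus>i\<in>A. f i j)"
  using assms(1,3)
proof (induction A rule: finite_induct)
  case empty
  then show ?case by simp
next
  case (insert a A)
  have "(\<Oplus>i\<in>insert a A. \<Oplus>j\<in>B. f i j) = (\<Oplus>j\<in>B. f a j) \<oplus> (\<Oplus>j\<in>B. \<Oplus>i\<in>A. f i j)"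
    using insert by (subst finsum_insert) (auto intro!: finsum_closed)
  also have "\<dots> = (\<Oplus>j\<in>B. f a j \<oplus> (\<Oplus>i\<in>A. f i j))"
    using insert by (subst finsum_addf) (auto intro!: finsum_closed)
  also have "\<dots> = (\<Oplus>j\<in>B. \<Oplus>i\<in>insert a A. f i j)"
    using insert by (intro finsum_cong') (auto intro!: finsum_closed)
  finally show ?case .
qed

text \<open>
  Determinants are formed over a type of class \<open>comm_ring_1\<close>, whereas \<open>F\<close> and its
  subfield are carriers of records. The subfield is therefore presented as the image of a
  subring \<open>C\<close> of such a type. A matrix over the subfield is lifted entrywise to \<open>C\<close>, and
  the image under \<open>\<eta>\<close> of the determinant of the lift does not depend on the lift, as
  \<open>\<eta>_det_cong\<close> shows. The map \<open>\<eta>\<close> need not be injective: for the \<open>p\<close>-adic numbers,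
  \<open>C\<close> consists of the Cauchy sequences of rational numbers.
\<close>
locale ring_lift = field F for F :: "('a, 'm) ring_scheme" (structure) +
  fixes C :: "'r::comm_ring_1 set" and \<eta> :: "'r \<Rightarrow> 'a"
  assumes one_C: "1 \<in> C"
    and uminus_C: "\<And>x. x \<in> C \<Longrightarrow> - x \<in> C"
    and add_C: "\<And>x y. x \<in> C \<Longrightarrow> y \<in> C \<Longrightarrow> x + y \<in> C"
    and mult_C: "\<And>x y. x \<in> C \<Longrightarrow> y \<in> C \<Longrightarrow> x * y \<in> C"
    and \<eta>_closed: "\<And>x. x \<in> C \<Longrightarrow> \<eta> x \<in> carrier F"
    and \<eta>_one: "\<eta> 1 = \<one>"
    and \<eta>_add: "\<And>x y. x \<in> C \<Longrightarrow> y \<in> C \<Longrightarrow> \<eta> (x + y) = \<eta> x \<oplus> \<eta> y"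
    and \<eta>_mult: "\<And>x y. x \<in> C \<Longrightarrow> y \<in> C \<Longrightarrow> \<eta> (x * y) = \<eta> x \<otimes> \<eta> y"
    and subfield_image: "subfield (\<eta> ` C) F"
    and finite_dim: "finite_dimension (\<eta> ` C) (carrier F)"
begin

lemma zero_C: "0 \<in> C"
  using add_C[OF one_C uminus_C[OF one_C]] by simp

lemma \<eta>_zero: "\<eta> 0 = \<zero>"
  using \<eta>_add[OF zero_C zero_C] \<eta>_closed[OF zero_C] by (simp add: add.l_cancel_one)

lemma sum_C: "(\<And>i. i \<in> I \<Longrightarrow> f i \<in> C) \<Longrightarrow> sum f I \<in> C"
  by (induction I rule: infinite_finite_induct) (auto simp: zero_C add_C)

lemma prod_C: "(\<And>i. i \<in> I \<Longrightarrow> f i \<in> C) \<Longrightarrow> prod f I \<in> C"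
  by (induction I rule: infinite_finite_induct) (auto simp: one_C mult_C)

lemma \<eta>_sum: "finite I \<Longrightarrow> (\<And>i. i \<in> I \<Longrightarrow> f i \<in> C) \<Longrightarrow> \<eta> (sum f I) = (\<Oplus>i\<in>I. \<eta> (f i))"
proof (induction I rule: finite_induct)
  case empty
  then show ?case by (simp add: \<eta>_zero)
next
  case (insert i I)
  then show ?case by (subst finsum_insert) (auto simp: \<eta>_add sum_C \<eta>_closed)
qed

lemma \<eta>_sum_cong: 
  "(\<And>i. i \<in> I \<Longrightarrow> f i \<in> C \<and> g i \<in> C \<and> \<eta> (f i) = \<eta> (g i)) \<Longrightarrow> \<eta> (sum f I) = \<eta> (sum g I)"
  by (induction I rule: infinite_finite_induct) (auto simp: \<eta>_add sum_C)

lemma \<eta>_prod_cong: 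
  "(\<And>i. i \<in> I \<Longrightarrow> f i \<in> C \<and> g i \<in> C \<and> \<eta> (f i) = \<eta> (g i)) \<Longrightarrow> \<eta> (prod f I) = \<eta> (prod g I)"
  by (induction I rule: infinite_finite_induct) (auto simp: \<eta>_mult prod_C)

lemma signof_C: "signof p \<in> C"
  by (auto simp: sign_def one_C uminus_C)

lemma det_term_C:
  assumes "p permutes {0..<n}" "\<And>i j. i < n \<Longrightarrow> j < n \<Longrightarrow> A $$ (i, j) \<in> C"
  shows "(\<Prod>i = 0..<n. A $$ (i, p i)) \<in> C"
  using assms permutes_in_image[OF assms(1)] by (intro prod_C) auto

lemma det_C:
  assumes "A \<in> carrier_mat n n" "\<And>i j. i < n \<Longrightarrow> j < n \<Longrightarrow> A $$ (i, j) \<in> C"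
  shows "det A \<in> C"
  unfolding det_def'[OF assms(1)] using assms(2)
  by (intro sum_C mult_C signof_C det_term_C) auto

lemma \<eta>_det_cong:
  assumes A: "A \<in> carrier_mat n n" and B: "B \<in> carrier_mat n n"
    and "\<And>i j. i < n \<Longrightarrow> j < n \<Longrightarrow> A $$ (i, j) \<in> C \<and> B $$ (i, j) \<in> C \<and> \<eta> (A $$ (i, j)) = \<eta> (B $$ (i, j))"
  shows "\<eta> (det A) = \<eta> (det B)"
  unfolding det_def'[OF A] det_def'[OF B]
proof (rule \<eta>_sum_cong)
  fix p assume "p \<in> {p. p permutes {0..<n}}"
  then have p: "p permutes {0..<n}" by simp
  have "\<eta> (\<Prod>i = 0..<n. A $$ (i, p i)) = \<eta> (\<Prod>i = 0..<n. B $$ (i, p i))"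
    using assms(3) permutes_in_image[OF p] by (intro \<eta>_prod_cong) auto
  then show "signof p * (\<Prod>i = 0..<n. A $$ (i, p i)) \<in> C \<and>
      signof p * (\<Prod>i = 0..<n. B $$ (i, p i)) \<in> C \<and>
      \<eta> (signof p * (\<Prod>i = 0..<n. A $$ (i, p i))) = \<eta> (signof p * (\<Prod>i = 0..<n. B $$ (i, p i)))"
    using assms(3) p by (simp add: mult_C signof_C det_term_C \<eta>_mult)
qed

text \<open>
  Coordinates with respect to a basis \<open>b\<close> of \<open>F\<close> over the subfield, already lifted to
  \<open>C\<close>; they are unique up to the kernel of \<open>\<eta>\<close>.
\<close>
lemma lifted_coordinates:
  obtains n :: nat and b c where
    "n > 0" "\<And>i. i < n \<Longrightarrow> b i \<in> carrier F"
    "\<And>x i. x \<in> carrier F \<Longrightarrow> i < n \<Longrightarrow> c x i \<in> C"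
    "\<And>x. x \<in> carrier F \<Longrightarrow> x = (\<Oplus>i\<in>{..<n}. \<eta> (c x i) \<otimes> b i)"
    "\<And>d x i. (\<And>i. i < n \<Longrightarrow> d i \<in> C) \<Longrightarrow> x = (\<Oplus>i\<in>{..<n}. \<eta> (d i) \<otimes> b i) \<Longrightarrow> i < n \<Longrightarrow> \<eta> (c x i) = \<eta> (d i)"
proof -
  let ?K = "\<eta> ` C"
  obtain n where "dimension n ?K (carrier F)" using finite_dim by (rule finite_dimensionE')
  then obtain Us where Us: "set Us \<subseteq> carrier F" "independent ?K Us" "Span ?K Us = carrier F"
    using exists_base[OF subfield_image] by blast
  have K: "?K \<subseteq> carrier F" using \<eta>_closed by auto
  have ex: "\<exists>!Ks. set Ks \<subseteq> ?K \<and> length Ks = length Us \<and> x = combine Ks Us" if "x \<in> carrier F" for x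
    using unique_decomposition[OF subfield_image Us(2)] Us(3) that by simp
  define k where "k x = (THE Ks. set Ks \<subseteq> ?K \<and> length Ks = length Us \<and> x = combine Ks Us)" for x
  have k: "set (k x) \<subseteq> ?K \<and> length (k x) = length Us \<and> x = combine (k x) Us" if "x \<in> carrier F" for x
    unfolding k_def by (rule theI') (rule ex[OF that])
  define c where "c x i = (SOME r. r \<in> C \<and> \<eta> r = k x ! i)" for x i
  have c: "c x i \<in> C \<and> \<eta> (c x i) = k x ! i" if "x \<in> carrier F" "i < length Us" for x i
  proof -
    have "k x ! i \<in> ?K" using k[OF that(1)] that(2) by (metis nth_mem subsetD)
    then show ?thesis unfolding c_def by (intro someI_ex[of "\<lambda>r. r \<in> C \<and> \<eta> r = k x ! i"]) auto
  qed
  show thesis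
  proof (rule that[of "length Us" "\<lambda>i. Us ! i" c])
    show "length Us > 0"
    proof (rule ccontr)
      assume "\<not> length Us > 0"
      then have "carrier F = {\<zero>}" using Us(3) by simp
      then show False using one_closed zero_not_one by (metis singletonD)
    qed
    show b: "Us ! i \<in> carrier F" if "i < length Us" for i using Us(1) nth_mem[OF that] by blast
    show "c x i \<in> C" if "x \<in> carrier F" "i < length Us" for x i using c that by blast
    show "x = (\<Oplus>i\<in>{..<length Us}. \<eta> (c x i) \<otimes> Us ! i)" if x: "x \<in> carrier F" for x
    proof -
      have "x = (\<Oplus>i\<in>{..<length Us}. k x ! i \<otimes> Us ! i)"
        using k[OF x] combine_eq_finsum[of "k x" Us] K Us(1) by auto
      also have "\<dots> = (\<Oplus>i\<in>{..<length Us}. \<eta> (c x i) \<otimes> Us ! i)"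
      proof (rule finsum_cong')
        fix i assume "i \<in> {..<length Us}"
        then show "k x ! i \<otimes> Us ! i = \<eta> (c x i) \<otimes> Us ! i" using c[OF x] by simp
      next
        show "(\<lambda>i. \<eta> (c x i) \<otimes> Us ! i) \<in> {..<length Us} \<rightarrow> carrier F"
          using c[OF x] b \<eta>_closed by (intro funcsetI m_closed) blast+
      qed simp
      finally show ?thesis .
    qed
    fix d x i
    assume d: "\<And>i. i < length Us \<Longrightarrow> d i \<in> C" and x: "x = (\<Oplus>i\<in>{..<length Us}. \<eta> (d i) \<otimes> Us ! i)"
      and i: "i < length Us"
    have xc: "x \<in> carrier F" unfolding x using d b \<eta>_closed by (intro finsum_closed) auto
    let ?d = "map (\<lambda>i. \<eta> (d i)) [0..<length Us]"
    have dK: "set ?d \<subseteq> ?K" using d by auto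
    then have "combine ?d Us = (\<Oplus>i\<in>{..<length Us}. ?d ! i \<otimes> Us ! i)"
      using K Us(1) by (intro combine_eq_finsum) auto
    also have "\<dots> = x"
      unfolding x using d b \<eta>_closed by (intro finsum_cong') auto
    finally have "set ?d \<subseteq> ?K \<and> length ?d = length Us \<and> x = combine ?d Us"
      using dK by (intro conjI) (simp_all only: length_map length_upt diff_zero)
    then have "k x = ?d" unfolding k_def by (rule the1_equality[OF ex[OF xc]])
    then show "\<eta> (c x i) = \<eta> (d i)" using c[OF xc i] i by simp
  qed
qed

text \<open>
  Here \<open>M a\<close> is a lift of the matrix of multiplication by \<open>a\<close>, and \<open>\<eta> (N a)\<close> is the
  norm of \<open>a\<close>. As the norm is multiplicative and \<open>\<nu>\<close> depends only on images under
  \<open>\<eta>\<close>, the map \<open>a \<mapsto> \<nu> (N a)\<close> is a homomorphism; at \<open>\<eta> t\<close> it takes the value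
  \<open>n \<nu> t\<close>, which is not zero.
\<close>
lemma decomposable_by_hom_on_subfield:
  fixes \<nu> :: "'r \<Rightarrow> int"
  assumes \<nu>_mult: "\<And>x y. x \<in> C \<Longrightarrow> y \<in> C \<Longrightarrow> \<eta> x \<noteq> \<zero> \<Longrightarrow> \<eta> y \<noteq> \<zero> \<Longrightarrow> \<nu> (x * y) = \<nu> x + \<nu> y"
    and \<nu>_cong: "\<And>x y. x \<in> C \<Longrightarrow> y \<in> C \<Longrightarrow> \<eta> x \<noteq> \<zero> \<Longrightarrow> \<eta> x = \<eta> y \<Longrightarrow> \<nu> x = \<nu> y"
    and t: "t \<in> C" "\<eta> t \<noteq> \<zero>" "\<nu> t \<noteq> 0"
  shows "\<not> indecomposable (Multiplicative_Group.mult_of F)"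
proof (rule lifted_coordinates)
  fix n :: nat and b c
  assume n: "n > 0" and b: "\<And>i. i < n \<Longrightarrow> b i \<in> carrier F"
    and c: "\<And>x i. x \<in> carrier F \<Longrightarrow> i < n \<Longrightarrow> c x i \<in> C"
    and expand: "\<And>x. x \<in> carrier F \<Longrightarrow> x = (\<Oplus>i\<in>{..<n}. \<eta> (c x i) \<otimes> b i)"
    and unique: "\<And>d x i. (\<And>i. i < n \<Longrightarrow> d i \<in> C) \<Longrightarrow> x = (\<Oplus>i\<in>{..<n}. \<eta> (d i) \<otimes> b i) \<Longrightarrow> i < n \<Longrightarrow> \<eta> (c x i) = \<eta> (d i)"
  define M where "M a = mat n n (\<lambda>(i, j). c (a \<otimes> b j) i)" for a
  define N where "N a = det (M a)" for a
  have M: "M a \<in> carrier_mat n n" for a by (simp add: M_def)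
  have MC: "M a $$ (i, j) \<in> C" if "a \<in> carrier F" "i < n" "j < n" for a i j
    using that b c by (simp add: M_def)
  have NC: "N a \<in> C" if "a \<in> carrier F" for a
    unfolding N_def using M MC[OF that] by (rule det_C)
  have ab: "a \<otimes> b j \<in> carrier F" if "a \<in> carrier F" "j < n" for a j using that b by simp
  have \<eta>c: "\<eta> (c (a \<otimes> b j) i) \<in> carrier F" if "a \<in> carrier F" "i < n" "j < n" for a i j
    using that ab c \<eta>_closed by blast
  have N_mult: "\<eta> (N (a \<otimes> a')) = \<eta> (N a) \<otimes> \<eta> (N a')" if a: "a \<in> carrier F" "a' \<in> carrier F" for a a'
  proof -
    have prod: "(M a * M a') $$ (i, j) = (\<Sum>k<n. c (a \<otimes> b k) i * c (a' \<otimes> b j) k)" if "i < n" "j < n" for i j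
      using that by (simp add: M_def scalar_prod_def atLeast0LessThan)
    have prodC: "(M a * M a') $$ (i, j) \<in> C" if "i < n" "j < n" for i j
      unfolding prod[OF that] using a that by (intro sum_C mult_C c ab) auto
    \<comment> \<open>Both sides are coordinates of \<open>a a' b\<^sub>j\<close>; uniqueness identifies them modulo the kernel of \<open>\<eta>\<close>.\<close>
    have "\<eta> (c (a \<otimes> a' \<otimes> b j) i) = \<eta> ((M a * M a') $$ (i, j))" if ij: "i < n" "j < n" for i j
    proof (rule unique[of "\<lambda>i. (M a * M a') $$ (i, j)"])
      let ?g = "\<lambda>i k. \<eta> (c (a \<otimes> b k) i) \<otimes> \<eta> (c (a' \<otimes> b j) k) \<otimes> b i"
      have g: "?g i k \<in> carrier F" if "i < n" "k < n" for i k
        using that a ij b \<eta>c by simp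
      have "a \<otimes> a' \<otimes> b j = a \<otimes> (\<Oplus>k\<in>{..<n}. \<eta> (c (a' \<otimes> b j) k) \<otimes> b k)"
        using expand[OF ab[OF a(2) ij(2)]] a b[OF ij(2)] by (simp add: m_assoc)
      also have "\<dots> = (\<Oplus>k\<in>{..<n}. a \<otimes> (\<eta> (c (a' \<otimes> b j) k) \<otimes> b k))"
        using a ij b \<eta>c by (intro finsum_rdistr) auto
      also have "\<dots> = (\<Oplus>k\<in>{..<n}. \<Oplus>i\<in>{..<n}. ?g i k)"
      proof (rule finsum_cong')
        fix k assume "k \<in> {..<n}"
        then have k: "k < n" by simp
        have "a \<otimes> (\<eta> (c (a' \<otimes> b j) k) \<otimes> b k) = \<eta> (c (a' \<otimes> b j) k) \<otimes> (a \<otimes> b k)"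
          using a ij k b \<eta>c by (simp add: m_lcomm)
        also have "\<dots> = \<eta> (c (a' \<otimes> b j) k) \<otimes> (\<Oplus>i\<in>{..<n}. \<eta> (c (a \<otimes> b k) i) \<otimes> b i)"
          using expand[OF ab[OF a(1) k]] by simp
        also have "\<dots> = (\<Oplus>i\<in>{..<n}. \<eta> (c (a' \<otimes> b j) k) \<otimes> (\<eta> (c (a \<otimes> b k) i) \<otimes> b i))"
          using a ij k b \<eta>c by (intro finsum_rdistr) auto
        also have "\<dots> = (\<Oplus>i\<in>{..<n}. ?g i k)"
          using a ij k b \<eta>c by (intro finsum_cong') (auto simp: m_ac)
        finally show "a \<otimes> (\<eta> (c (a' \<otimes> b j) k) \<otimes> b k) = (\<Oplus>i\<in>{..<n}. ?g i k)" .
      qed (use g in \<open>auto intro!: finsum_closed\<close>)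
      also have "\<dots> = (\<Oplus>i\<in>{..<n}. \<Oplus>k\<in>{..<n}. ?g i k)"
        using g by (intro finsum_swap) auto
      also have "\<dots> = (\<Oplus>i\<in>{..<n}. \<eta> ((M a * M a') $$ (i, j)) \<otimes> b i)"
      proof (rule finsum_cong')
        fix i assume "i \<in> {..<n}"
        then have i: "i < n" by simp
        have "\<eta> ((M a * M a') $$ (i, j)) = (\<Oplus>k\<in>{..<n}. \<eta> (c (a \<otimes> b k) i * c (a' \<otimes> b j) k))"
          unfolding prod[OF i ij(2)] using a i ij by (intro \<eta>_sum mult_C c ab) auto
        also have "\<dots> = (\<Oplus>k\<in>{..<n}. \<eta> (c (a \<otimes> b k) i) \<otimes> \<eta> (c (a' \<otimes> b j) k))"
          using a i ij \<eta>c by (intro finsum_cong') (auto simp: \<eta>_mult c ab)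
        finally show "(\<Oplus>k\<in>{..<n}. ?g i k) = \<eta> ((M a * M a') $$ (i, j)) \<otimes> b i"
          using a i ij b \<eta>c by (subst finsum_ldistr[symmetric]) auto
      qed (use prodC \<eta>_closed b ij in auto)
      finally show "a \<otimes> a' \<otimes> b j = (\<Oplus>i\<in>{..<n}. \<eta> ((M a * M a') $$ (i, j)) \<otimes> b i)" .
    qed (use prodC ij in auto)
    then have "\<eta> (N (a \<otimes> a')) = \<eta> (det (M a * M a'))"
      unfolding N_def using MC[of "a \<otimes> a'"] prodC a M
      by (intro \<eta>_det_cong[of _ n]) (auto simp: M_def)
    also have "det (M a * M a') = N a * N a'" unfolding N_def by (rule det_mult[OF M M])
    finally show ?thesis using NC a by (simp add: \<eta>_mult)
  qed
  have N_image: "\<eta> (N (\<eta> r)) = \<eta> (r ^ n)" if r: "r \<in> C" for r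
  proof -
    \<comment> \<open>Multiplication by a scalar has a scalar matrix, up to the choice of lifts.\<close>
    have "\<eta> (det (M (\<eta> r))) = \<eta> (det (r \<cdot>\<^sub>m 1\<^sub>m n))"
    proof (rule \<eta>_det_cong[OF M])
      fix i j assume ij: "i < n" "j < n"
      have "\<eta> (c (\<eta> r \<otimes> b j) i) = \<eta> (if i = j then r else 0)"
      proof (rule unique)
        show "\<eta> r \<otimes> b j = (\<Oplus>i\<in>{..<n}. \<eta> (if i = j then r else 0) \<otimes> b i)"
        proof -
          have "(\<Oplus>i\<in>{..<n}. \<eta> (if i = j then r else 0) \<otimes> b i) =
              (\<Oplus>i\<in>{..<n}. if i = j then \<eta> r \<otimes> b i else \<zero>)"
            using b r \<eta>_closed by (intro finsum_cong') (auto simp: \<eta>_zero)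
          also have "\<dots> = \<eta> r \<otimes> b j"
            using ij b r \<eta>_closed by (intro add.finprod_singleton_swap) auto
          finally show ?thesis by simp
        qed
      qed (use ij r zero_C in auto)
      then show "M (\<eta> r) $$ (i, j) \<in> C \<and> (r \<cdot>\<^sub>m 1\<^sub>m n) $$ (i, j) \<in> C \<and>
           \<eta> (M (\<eta> r) $$ (i, j)) = \<eta> ((r \<cdot>\<^sub>m 1\<^sub>m n) $$ (i, j))"
        using ij r MC[of "\<eta> r"] \<eta>_closed zero_C by (auto simp: M_def)
    qed simp
    then show ?thesis by (simp add: N_def)
  qed
  have N_nonzero: "\<eta> (N a) \<noteq> \<zero>" if "a \<in> carrier F - {\<zero>}" for a
  proof -
    have "\<eta> (N a) \<otimes> \<eta> (N (inv a)) = \<eta> (N \<one>)"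
      using N_mult[of a "inv a"] that field_Units by simp
    also have "\<dots> = \<one>" using N_image[OF one_C] by (simp add: \<eta>_one)
    finally show ?thesis using NC[of "inv a"] that field_Units \<eta>_closed by force
  qed
  have pow: "r ^ k \<in> C \<and> \<eta> (r ^ k) \<noteq> \<zero> \<and> \<nu> (r ^ Suc k) = int (Suc k) * \<nu> r" if "r \<in> C" "\<eta> r \<noteq> \<zero>" for r k
  proof (induction k)
    case 0
    then show ?case by (simp add: one_C \<eta>_one)
  next
    case (Suc k)
    then have "r ^ Suc k \<in> C \<and> \<eta> (r ^ Suc k) \<noteq> \<zero>"
      using that by (simp add: mult_C \<eta>_mult \<eta>_closed integral_iff)
    then show ?case
      using Suc that \<nu>_mult[of r "r ^ Suc k"] by (simp add: algebra_simps)
  qed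
  show ?thesis
  proof (rule decomposable_by_int_valued_hom[where \<phi> = "\<lambda>a. \<nu> (N a)" and s = "\<eta> t"])
    show "field F" by (rule field_axioms)
    fix x y assume xy: "x \<in> carrier F - {\<zero>}" "y \<in> carrier F - {\<zero>}"
    then have "\<nu> (N (x \<otimes> y)) = \<nu> (N x * N y)"
      by (intro \<nu>_cong N_nonzero) (auto simp: NC mult_C N_mult \<eta>_mult integral_iff)
    then show "\<nu> (N (x \<otimes> y)) = \<nu> (N x) + \<nu> (N y)"
      using xy by (simp add: \<nu>_mult NC N_nonzero)
  next
    show t0: "\<eta> t \<in> carrier F - {\<zero>}" using t \<eta>_closed by simp
    have "\<nu> (N (\<eta> t)) = \<nu> (t ^ n)"
      using N_image[OF t(1)] N_nonzero[OF t0] NC t0 pow[OF t(1,2)] by (intro \<nu>_cong) auto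
    then show "\<nu> (N (\<eta> t)) \<noteq> 0" using pow[OF t(1,2), of "n - 1"] n t(3) by simp
  qed
qed

end


section \<open>Leading terms and the p-adic valuation\<close>

text \<open>
  In an ordered cancellative monoid the product of the greatest monomials arises from no other pair of
  monomials, so nothing can cancel there. Hence any homomorphism on monomials or on nonzero coefficients
  extends to nonzero polynomials by evaluation at the leading term.
\<close>
lemma leading_term_mult:
  fixes p q :: "'a::{ordered_cancel_comm_monoid_add, linorder} \<Rightarrow>\<^sub>0 'b::semiring_no_zero_divisors"
  assumes "p \<noteq> 0" "q \<noteq> 0"
  defines "a \<equiv> Max (Poly_Mapping.keys p)" and "b \<equiv> Max (Poly_Mapping.keys q)"
  shows "Max (Poly_Mapping.keys (p * q)) = a + b"
    and "Poly_Mapping.lookup (p * q) (a + b) = Poly_Mapping.lookup p a * Poly_Mapping.lookup q b"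
proof -
  let ?l = Poly_Mapping.lookup
  have ab: "a \<in> Poly_Mapping.keys p" "b \<in> Poly_Mapping.keys q"
    using assms by (auto intro!: Max_in)
  have le: "?l p x \<noteq> 0 \<Longrightarrow> x \<le> a" "?l q x \<noteq> 0 \<Longrightarrow> x \<le> b" for x
    by (auto simp: a_def b_def in_keys_iff)
  have eq: "x = a \<and> y = b" if "?l p x \<noteq> 0" "?l q y \<noteq> 0" "a + b = x + y" for x y
    using le(1)[OF that(1)] le(2)[OF that(2)] that(3) add_less_le_mono[of x a y b] add_le_less_mono[of x a y b]
    by (metis order_less_irrefl order_le_imp_less_or_eq)
  have "?l (p * q) (a + b) = (\<Sum>(x, y). ?l p x * ?l q y when a + b = x + y)"
    by (simp add: times_poly_mapping.rep_eq prod_fun_unfold_prod)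
  also have "\<dots> = (\<Sum>(x, y)\<in>{(a, b)}. ?l p x * ?l q y when a + b = x + y)"
    by (rule Sum_any.expand_superset) (auto dest: eq simp: when_def split: if_splits)
  finally show l: "?l (p * q) (a + b) = ?l p a * ?l q b" by simp
  show "Max (Poly_Mapping.keys (p * q)) = a + b"
  proof (rule Max_eqI)
    show "a + b \<in> Poly_Mapping.keys (p * q)" using ab l by (simp add: in_keys_iff)
    fix z assume "z \<in> Poly_Mapping.keys (p * q)"
    then obtain x y where "z = x + y" "x \<in> Poly_Mapping.keys p" "y \<in> Poly_Mapping.keys q"
      using keys_mult[of p q] by blast
    then show "z \<le> a + b" using le by (simp add: add_mono in_keys_iff)
  qed simp
qed

text \<open>The exponent in \<^const>\<open>padic_norm\<close>, with the sign that makes it a valuation.\<close>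
definition padic_val :: "nat \<Rightarrow> rat \<Rightarrow> int" where
  "padic_val p x = int (multiplicity (int p) (fst (quotient_of x)))
                 - int (multiplicity (int p) (snd (quotient_of x)))"

lemma padic_norm_eq: "padic_norm p x = (if x = 0 then 0 else real p powi (- padic_val p x))"
  by (simp add: padic_norm_def padic_val_def)

context
  fixes p :: nat assumes p: "Factorial_Ring.prime p"
begin

lemma multiplicity_int_mult:
  "a \<noteq> 0 \<Longrightarrow> b \<noteq> 0 \<Longrightarrow> multiplicity (int p) (a * b) = multiplicity (int p) a + multiplicity (int p) b"
  using p by (intro prime_elem_multiplicity_mult_distrib) auto

text \<open>
  Freedom to use fractions that are not in lowest terms is what makes sums and products accessible.
\<close>
lemma padic_val_divide:
  assumes "a \<noteq> 0" "b \<noteq> 0"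
  shows "padic_val p (of_int a / of_int b) = int (multiplicity (int p) a) - int (multiplicity (int p) b)"
proof -
  obtain n d where nd: "quotient_of (of_int a / of_int b) = (n, d)" by fastforce
  have d: "d > 0" using nd by (rule quotient_of_denom_pos)
  have eq: "of_int a / of_int b = (of_int n / of_int d :: rat)" using nd by (rule quotient_of_div)
  then have "of_int (a * d) = (of_int (n * b) :: rat)" using assms d by (simp add: field_simps)
  then have "a * d = n * b" by (simp only: of_int_eq_iff)
  moreover from this have "n \<noteq> 0" using assms d by auto
  ultimately have "multiplicity (int p) a + multiplicity (int p) d = multiplicity (int p) n + multiplicity (int p) b"
    using assms d by (metis multiplicity_int_mult less_irrefl)
  then show ?thesis unfolding padic_val_def nd by simp
qed

lemma rat_nonzero_cases:
  fixes x :: rat assumes "x \<noteq> 0"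
  obtains a b where "a \<noteq> 0" "b \<noteq> 0" "x = of_int a / of_int b"
  using assms quotient_of_div[of x] quotient_of_denom_pos[of x]
  by (metis div_0 less_irrefl of_int_0 surj_pair)

lemma padic_val_mult:
  assumes "x \<noteq> 0" "y \<noteq> 0" shows "padic_val p (x * y) = padic_val p x + padic_val p y"
proof -
  obtain a b where x: "a \<noteq> 0" "b \<noteq> 0" "x = of_int a / of_int b" using assms(1) by (rule rat_nonzero_cases)
  obtain c d where y: "c \<noteq> 0" "d \<noteq> 0" "y = of_int c / of_int d" using assms(2) by (rule rat_nonzero_cases)
  have "padic_val p (x * y) = padic_val p (of_int (a * c) / of_int (b * d))" by (simp add: x y)
  also have "\<dots> = padic_val p x + padic_val p y"
    using x y padic_val_divide[of "a * c" "b * d"] by (simp add: padic_val_divide multiplicity_int_mult)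
  finally show ?thesis .
qed

lemma padic_val_add:
  assumes "x \<noteq> 0" "y \<noteq> 0" "x + y \<noteq> 0" shows "padic_val p (x + y) \<ge> min (padic_val p x) (padic_val p y)"
proof -
  obtain a b where x: "a \<noteq> 0" "b \<noteq> 0" "x = of_int a / of_int b" using assms(1) by (rule rat_nonzero_cases)
  obtain c d where y: "c \<noteq> 0" "d \<noteq> 0" "y = of_int c / of_int d" using assms(2) by (rule rat_nonzero_cases)
  let ?m = "multiplicity (int p)"
  have s: "x + y = of_int (a * d + c * b) / of_int (b * d)" using x y by (simp add: field_simps)
  then have nz: "a * d + c * b \<noteq> 0" using assms(3) by (metis div_0 of_int_0)
  let ?k = "min (?m (a * d)) (?m (c * b))"
  have "int p ^ ?k dvd a * d + c * b"
    by (intro dvd_add multiplicity_dvd') auto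
  then have "?k \<le> ?m (a * d + c * b)"
    using nz p by (intro multiplicity_geI) (auto simp: prime_gt_1_nat dest: prime_gt_1_nat)
  moreover have "padic_val p (x + y) = int (?m (a * d + c * b)) - int (?m (b * d))"
    unfolding s using nz x y by (intro padic_val_divide) auto
  moreover have "padic_val p x = int (?m a) - int (?m b)" "padic_val p y = int (?m c) - int (?m d)"
    using x y by (simp_all add: padic_val_divide)
  ultimately show ?thesis
    using x y by (simp add: multiplicity_int_mult min_def split: if_splits)
qed

lemma padic_val_minus: "padic_val p (- x) = padic_val p x"
  by (cases "x = 0") (use padic_val_mult[of "-1" x] padic_val_divide[of "-1" 1] p in auto)

lemma padic_val_self: "padic_val p (of_nat p) = 1"
  using padic_val_divide[of "int p" 1] p by (auto simp: prime_gt_0_nat multiplicity_self dest: prime_gt_1_nat)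

end


section \<open>Function fields and number fields\<close>

text \<open>
  The form of \<open>decomposable_by_hom_on_subfield\<close> in which \<open>\<epsilon>\<close> presents the base field
  \<open>E\<close> itself; since the embedding of \<open>E\<close> into \<open>F\<close> is injective, it does not
  affect the conditions on \<open>\<nu>\<close>.
\<close>
lemma finite_extension_decomposes:
  fixes F :: "('a, 'm) ring_scheme" and E :: "('e, 'n) ring_scheme"
    and C :: "'r::comm_ring_1 set" and \<epsilon> :: "'r \<Rightarrow> 'e" and \<nu> :: "'r \<Rightarrow> int"
  assumes ext: "finite_extension E F"
    and C: "1 \<in> C" "\<And>x. x \<in> C \<Longrightarrow> - x \<in> C"
      "\<And>x y. x \<in> C \<Longrightarrow> y \<in> C \<Longrightarrow> x + y \<in> C" "\<And>x y. x \<in> C \<Longrightarrow> y \<in> C \<Longrightarrow> x * y \<in> C"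
    and surj: "\<epsilon> ` C = carrier E" and \<epsilon>_one: "\<epsilon> 1 = \<one>\<^bsub>E\<^esub>"
    and \<epsilon>_add: "\<And>x y. x \<in> C \<Longrightarrow> y \<in> C \<Longrightarrow> \<epsilon> (x + y) = \<epsilon> x \<oplus>\<^bsub>E\<^esub> \<epsilon> y"
    and \<epsilon>_mult: "\<And>x y. x \<in> C \<Longrightarrow> y \<in> C \<Longrightarrow> \<epsilon> (x * y) = \<epsilon> x \<otimes>\<^bsub>E\<^esub> \<epsilon> y"
    and \<nu>_mult: "\<And>x y. x \<in> C \<Longrightarrow> y \<in> C \<Longrightarrow> \<epsilon> x \<noteq> \<zero>\<^bsub>E\<^esub> \<Longrightarrow> \<epsilon> y \<noteq> \<zero>\<^bsub>E\<^esub> \<Longrightarrow> \<nu> (x * y) = \<nu> x + \<nu> y"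
    and \<nu>_cong: "\<And>x y. x \<in> C \<Longrightarrow> y \<in> C \<Longrightarrow> \<epsilon> x \<noteq> \<zero>\<^bsub>E\<^esub> \<Longrightarrow> \<epsilon> x = \<epsilon> y \<Longrightarrow> \<nu> x = \<nu> y"
    and t: "t \<in> C" "\<epsilon> t \<noteq> \<zero>\<^bsub>E\<^esub>" "\<nu> t \<noteq> 0"
  shows "\<not> indecomposable (Multiplicative_Group.mult_of F)"
proof -
  obtain h where EF: "field E" "field F" and h: "h \<in> Ring.ring_hom E F"
    and fd: "ring.finite_dimension F (h ` carrier E) (carrier F)"
    using ext unfolding finite_extension_def by blast
  interpret E: field E by fact
  interpret F: field F by fact
  interpret h: ring_hom_ring E F h using h by (rule ring_hom_ringI2[OF E.is_ring F.is_ring])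
  have inj: "inj_on h (carrier E)" using h EF by (rule non_trivial_field_hom_is_inj)
  have \<epsilon>E: "\<epsilon> x \<in> carrier E" if "x \<in> C" for x using surj that by blast
  have img: "(\<lambda>x. h (\<epsilon> x)) ` C = h ` carrier E" unfolding surj[symmetric] by (simp add: image_image)
  have nz: "h (\<epsilon> x) = \<zero>\<^bsub>F\<^esub> \<longleftrightarrow> \<epsilon> x = \<zero>\<^bsub>E\<^esub>" if "x \<in> C" for x
    using inj_on_eq_iff[OF inj \<epsilon>E[OF that] E.zero_closed] unfolding h.hom_zero .
  have "subfield ((\<lambda>x. h (\<epsilon> x)) ` C) F"
    unfolding img by (rule h.img_is_subfield(2)[OF E.carrier_is_subfield]) simp
  moreover have "F.finite_dimension ((\<lambda>x. h (\<epsilon> x)) ` C) (carrier F)"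
    unfolding img by (rule fd)
  ultimately interpret ring_lift F C "\<lambda>x. h (\<epsilon> x)"
    using C by (intro ring_lift.intro F.field_axioms ring_lift_axioms.intro)
      (simp_all add: \<epsilon>E \<epsilon>_one \<epsilon>_add \<epsilon>_mult)
  show ?thesis
  proof (rule decomposable_by_hom_on_subfield[of \<nu> t])
    show "\<nu> x = \<nu> y" if "x \<in> C" "y \<in> C" "h (\<epsilon> x) \<noteq> \<zero>\<^bsub>F\<^esub>" "h (\<epsilon> x) = h (\<epsilon> y)" for x y
      using that inj_onD[OF inj that(4) \<epsilon>E[OF that(1)] \<epsilon>E[OF that(2)]] nz[OF that(1)]
      by (intro \<nu>_cong) auto
    show "\<nu> (x * y) = \<nu> x + \<nu> y"
      if "x \<in> C" "y \<in> C" "h (\<epsilon> x) \<noteq> \<zero>\<^bsub>F\<^esub>" "h (\<epsilon> y) \<noteq> \<zero>\<^bsub>F\<^esub>" for x y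
      using that nz by (intro \<nu>_mult) auto
  qed (use t nz[of t] in auto)
qed

lemma finite_extension_of_subring_decomposes:
  fixes F :: "('a, 'm) ring_scheme" and C :: "'r::field set" and \<nu> :: "'r \<Rightarrow> int"
  assumes ext: "finite_extension ((ring_of_type_algebra :: 'r ring)\<lparr>carrier := C\<rparr>) F"
    and \<nu>_mult: "\<And>x y. x \<noteq> 0 \<Longrightarrow> y \<noteq> 0 \<Longrightarrow> \<nu> (x * y) = \<nu> x + \<nu> y"
    and t: "t \<in> C" "t \<noteq> 0" "\<nu> t \<noteq> 0"
  shows "\<not> indecomposable (Multiplicative_Group.mult_of F)"
proof -
  let ?E = "(ring_of_type_algebra :: 'r ring)\<lparr>carrier := C\<rparr>"
  interpret E: field ?E using ext by (simp add: finite_extension_def)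
  note ops = ring_of_type_algebra_def
  have inv: "- x \<in> C" if "x \<in> C" for x
  proof -
    have "\<ominus>\<^bsub>?E\<^esub> x \<in> C" "x + \<ominus>\<^bsub>?E\<^esub> x = 0"
      using E.a_inv_closed[of x] E.r_neg[of x] that by (simp_all add: ops)
    then show ?thesis by (metis minus_unique)
  qed
  show ?thesis
  proof (rule finite_extension_decomposes[OF ext, of C "\<lambda>x. x" \<nu> t])
    show "1 \<in> C" using E.one_closed by (simp add: ops)
    show "x + y \<in> C" if "x \<in> C" "y \<in> C" for x y using E.a_closed[of x y] that by (simp add: ops)
    show "x * y \<in> C" if "x \<in> C" "y \<in> C" for x y using E.m_closed[of x y] that by (simp add: ops)
  qed (use t \<nu>_mult inv in \<open>simp_all add: ops\<close>)
qed

lemma hom_extends_to_fract: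
  fixes w :: "'d::idom \<Rightarrow> int"
  assumes w: "\<And>p q. p \<noteq> 0 \<Longrightarrow> q \<noteq> 0 \<Longrightarrow> w (p * q) = w p + w q"
  obtains \<nu> :: "'d fract \<Rightarrow> int" where
    "\<And>p q. p \<noteq> 0 \<Longrightarrow> q \<noteq> 0 \<Longrightarrow> \<nu> (Fract p q) = w p - w q"
    "\<And>x y. x \<noteq> 0 \<Longrightarrow> y \<noteq> 0 \<Longrightarrow> \<nu> (x * y) = \<nu> x + \<nu> y"
proof -
  define \<nu> where "\<nu> x = (SOME v. \<exists>p q. p \<noteq> 0 \<and> q \<noteq> 0 \<and> x = Fract p q \<and> v = w p - w q)" for x
  have \<nu>: "\<nu> (Fract p q) = w p - w q" if pq: "p \<noteq> 0" "q \<noteq> 0" for p q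
    unfolding \<nu>_def
  proof (rule some_equality)
    fix v assume "\<exists>p' q'. p' \<noteq> 0 \<and> q' \<noteq> 0 \<and> Fract p q = Fract p' q' \<and> v = w p' - w q'"
    then obtain p' q' where v: "p' \<noteq> 0" "q' \<noteq> 0" "Fract p q = Fract p' q'" "v = w p' - w q'" by blast
    then have "p * q' = p' * q" using pq by (simp add: eq_fract)
    then have "w p + w q' = w p' + w q" using v pq w by metis
    then show "v = w p - w q" using v by simp
  qed (use pq in blast)
  have cases: "\<exists>p q. p \<noteq> 0 \<and> q \<noteq> 0 \<and> x = Fract p q" if "x \<noteq> 0" for x :: "'d fract"
    using that by (cases x) (metis Fract_cases_nonzero)
  show thesis
  proof (rule that[of \<nu>, OF \<nu>])
    fix x y :: "'d fract" assume "x \<noteq> 0" "y \<noteq> 0"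
    then obtain p q r s where "p \<noteq> 0" "q \<noteq> 0" "x = Fract p q" "r \<noteq> 0" "s \<noteq> 0" "y = Fract r s"
      using cases by metis
    then show "\<nu> (x * y) = \<nu> x + \<nu> y" by (simp add: \<nu> w)
  qed
qed

lemma algebraic_function_field_decomposes:
  fixes w :: "((nat \<Rightarrow>\<^sub>0 nat) \<Rightarrow>\<^sub>0 'k::field) \<Rightarrow> int"
  assumes ext: "algebraic_function_field n TYPE('k) F"
    and w: "\<And>p q. p \<noteq> 0 \<Longrightarrow> q \<noteq> 0 \<Longrightarrow> w (p * q) = w p + w q"
    and t: "t \<in> polys_in n" "t \<noteq> 0" "w t \<noteq> 0"
  shows "\<not> indecomposable (Multiplicative_Group.mult_of F)"
proof -
  obtain \<nu> where \<nu>: "\<And>p q. p \<noteq> 0 \<Longrightarrow> q \<noteq> 0 \<Longrightarrow> \<nu> (Fract p q) = w p - w q"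
    "\<And>x y. x \<noteq> 0 \<Longrightarrow> y \<noteq> 0 \<Longrightarrow> \<nu> (x * y) = \<nu> x + \<nu> y"
    using hom_extends_to_fract[of w, OF w] by blast
  have one: "1 \<in> polys_in n" "w 1 = 0" using w[of 1 1] by (simp_all add: polys_in_def)
  show ?thesis
  proof (rule finite_extension_of_subring_decomposes[where \<nu> = \<nu> and t = "Fract t 1"])
    show "finite_extension ((ring_of_type_algebra :: ((nat \<Rightarrow>\<^sub>0 nat) \<Rightarrow>\<^sub>0 'k) fract ring)
       \<lparr>carrier := {Fract p q |p q. p \<in> polys_in n \<and> q \<in> polys_in n \<and> q \<noteq> 0}\<rparr>) F"
      using ext by (simp add: algebraic_function_field_def rational_functions_def)
    show "Fract t 1 \<in> {Fract p q |p q. p \<in> polys_in n \<and> q \<in> polys_in n \<and> q \<noteq> 0}"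
      using t(1) one(1) zero_neq_one by (metis (mono_tags, lifting) mem_Collect_eq)
    show "Fract t 1 \<noteq> 0" using t by (simp add: Zero_fract_def eq_fract)
    show "\<nu> (Fract t 1) \<noteq> 0" using t \<nu>(1)[of t 1] one by simp
  qed (rule \<nu>(2))
qed

text \<open>
  The homomorphism is the exponent of the first variable in the leading monomial.
\<close>
lemma function_field_decomposes:
  assumes "function_field TYPE('k::field) F"
  shows "\<not> indecomposable (Multiplicative_Group.mult_of F)"
proof -
  obtain n where n: "n \<ge> 1" "algebraic_function_field n TYPE('k) F"
    using assms by (auto simp: function_field_def)
  let ?w = "\<lambda>p. int (Poly_Mapping.lookup (Max (Poly_Mapping.keys (p :: (nat \<Rightarrow>\<^sub>0 nat) \<Rightarrow>\<^sub>0 'k))) 0)"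
  let ?t = "Poly_Mapping.single (Poly_Mapping.single 0 1) 1 :: (nat \<Rightarrow>\<^sub>0 nat) \<Rightarrow>\<^sub>0 'k"
  show ?thesis
  proof (rule algebraic_function_field_decomposes[OF n(2), where w = ?w and t = ?t])
    show "?w (p * q) = ?w p + ?w q" if "p \<noteq> 0" "q \<noteq> 0" for p q
      using leading_term_mult(1)[OF that] by (simp add: lookup_add)
    show "?t \<in> polys_in n" using n(1) by (auto simp: polys_in_def)
    have k: "Poly_Mapping.keys ?t = {Poly_Mapping.single 0 1}" by simp
    show "?t \<noteq> 0" using k by (metis insert_not_empty keys_zero)
    show "?w ?t \<noteq> 0" by simp
  qed
qed

text \<open>
  The 2-adic valuation of the leading coefficient works for every number of variables, including
  none, where there is no degree to use.
\<close>
lemma function_field_over_rat_decomposes: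
  assumes "algebraic_function_field n TYPE(rat) F"
  shows "\<not> indecomposable (Multiplicative_Group.mult_of F)"
proof -
  let ?w = "\<lambda>p. padic_val 2 (Poly_Mapping.lookup (p :: (nat \<Rightarrow>\<^sub>0 nat) \<Rightarrow>\<^sub>0 rat) (Max (Poly_Mapping.keys p)))"
  let ?t = "Poly_Mapping.single 0 2 :: (nat \<Rightarrow>\<^sub>0 nat) \<Rightarrow>\<^sub>0 rat"
  have lc: "Poly_Mapping.lookup p (Max (Poly_Mapping.keys p)) \<noteq> 0" if "p \<noteq> 0" for p :: "(nat \<Rightarrow>\<^sub>0 nat) \<Rightarrow>\<^sub>0 rat"
    using Max_in[of "Poly_Mapping.keys p"] that by (simp add: in_keys_iff)
  show ?thesis
  proof (rule algebraic_function_field_decomposes[OF assms, where w = ?w and t = ?t])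
    show "?w (p * q) = ?w p + ?w q" if "p \<noteq> 0" "q \<noteq> 0" for p q
      using leading_term_mult[OF that] lc that by (simp add: padic_val_mult two_is_prime_nat)
    have k: "Poly_Mapping.keys ?t = {0}" by (subst keys_single) simp
    show "?t \<in> polys_in n" unfolding polys_in_def mem_Collect_eq k by simp
    show "?t \<noteq> 0" using k by (metis insert_not_empty keys_zero)
    show "?w ?t \<noteq> 0"
      unfolding k Max_singleton lookup_single_eq using padic_val_self[OF two_is_prime_nat] by simp
  qed
qed

lemma number_field_decomposes:
  assumes "finite_extension (ring_of_type_algebra :: rat ring) F"
  shows "\<not> indecomposable (Multiplicative_Group.mult_of F)"
proof -
  have "(ring_of_type_algebra :: rat ring)\<lparr>carrier := UNIV\<rparr> = ring_of_type_algebra"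
    by (simp add: ring_of_type_algebra_def)
  with assms have "finite_extension ((ring_of_type_algebra :: rat ring)\<lparr>carrier := UNIV\<rparr>) F" by simp
  then show ?thesis
    by (rule finite_extension_of_subring_decomposes[where \<nu> = "padic_val 2" and t = 2])
      (use padic_val_self[OF two_is_prime_nat] in \<open>simp_all add: padic_val_mult two_is_prime_nat\<close>)
qed

lemma finite_extension_finite:
  assumes "finite_extension E F" "finite (carrier E)"
  shows "finite (carrier F)"
proof -
  obtain h where EF: "field E" "field F" and h: "h \<in> Ring.ring_hom E F"
    and fd: "ring.finite_dimension F (h ` carrier E) (carrier F)"
    using assms(1) unfolding finite_extension_def by blast
  interpret E: field E by fact
  interpret F: field F by fact
  interpret h: ring_hom_ring E F h using h by (rule ring_hom_ringI2[OF E.is_ring F.is_ring])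
  let ?K = "h ` carrier E"
  have K: "subfield ?K F" by (rule h.img_is_subfield(2)[OF E.carrier_is_subfield]) simp
  obtain n where "F.dimension n ?K (carrier F)" using fd by (rule F.finite_dimensionE')
  then obtain Us where "set Us \<subseteq> carrier F" "F.Span ?K Us = carrier F"
    using F.exists_base[OF K] by blast
  then have "carrier F = {F.combine Ks Us | Ks. length Ks = length Us \<and> set Ks \<subseteq> ?K}"
    using F.Span_eq_combine_set_length_version[OF K, of Us] by simp
  also have "\<dots> = (\<lambda>Ks. F.combine Ks Us) ` {Ks. set Ks \<subseteq> ?K \<and> length Ks = length Us}" by auto
  also have "finite \<dots>" using assms(2) by (intro finite_imageI finite_lists_length_eq) auto
  finally show ?thesis .
qed

lemma function_field_no_variables_finite:
  assumes "algebraic_function_field 0 TYPE('p::field) F" "finite (UNIV :: 'p set)"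
  shows "finite (carrier F)"
proof -
  have "p \<in> range (Poly_Mapping.single 0)" if "p \<in> polys_in 0" for p :: "(nat \<Rightarrow>\<^sub>0 nat) \<Rightarrow>\<^sub>0 'p"
  proof -
    have "Poly_Mapping.keys p \<subseteq> {0}" using that by (auto simp: polys_in_def)
    then have "p = Poly_Mapping.single 0 (Poly_Mapping.lookup p 0)"
      by (intro poly_mapping_eqI) (auto simp: lookup_single when_def in_keys_iff)
    then show ?thesis by (rule range_eqI)
  qed
  then have "polys_in 0 \<subseteq> range (Poly_Mapping.single 0 :: 'p \<Rightarrow> (nat \<Rightarrow>\<^sub>0 nat) \<Rightarrow>\<^sub>0 'p)"
    by (rule subsetI)
  then have "finite (polys_in 0 :: ((nat \<Rightarrow>\<^sub>0 nat) \<Rightarrow>\<^sub>0 'p) set)"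
    by (rule finite_subset) (rule finite_imageI[OF assms(2)])
  then have "finite ((\<lambda>(p, q). Fract p q) ` (polys_in 0 \<times> polys_in 0 :: (((nat \<Rightarrow>\<^sub>0 nat) \<Rightarrow>\<^sub>0 'p) \<times> _) set))"
    by (intro finite_imageI finite_cartesian_product)
  moreover have "carrier (rational_functions 0 :: ((nat \<Rightarrow>\<^sub>0 nat) \<Rightarrow>\<^sub>0 'p) fract ring)
      \<subseteq> (\<lambda>(p, q). Fract p q) ` (polys_in 0 \<times> polys_in 0)"
  proof
    fix x assume "x \<in> carrier (rational_functions 0 :: ((nat \<Rightarrow>\<^sub>0 nat) \<Rightarrow>\<^sub>0 'p) fract ring)"
    then obtain p q where "x = Fract p q" "p \<in> polys_in 0" "q \<in> polys_in 0"
      by (auto simp: rational_functions_def ring_of_type_algebra_def)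
    then show "x \<in> (\<lambda>(p, q). Fract p q) ` (polys_in 0 \<times> polys_in 0)"
      by (intro image_eqI[of _ _ "(p, q)"]) auto
  qed
  ultimately have "finite (carrier (rational_functions 0 :: ((nat \<Rightarrow>\<^sub>0 nat) \<Rightarrow>\<^sub>0 'p) fract ring))"
    by (rule finite_subset[rotated])
  with assms(1)[unfolded algebraic_function_field_def] show ?thesis
    by (rule finite_extension_finite)
qed

lemma finitely_generated_field_decomposes:
  assumes "finitely_generated_field TYPE('p::field) F" "infinite (carrier F)"
  shows "\<not> indecomposable (Multiplicative_Group.mult_of F)"
proof -
  obtain n where "Factorial_Ring.prime CARD('p) \<and> algebraic_function_field n TYPE('p) F \<or>
      algebraic_function_field n TYPE(rat) F"
    using assms(1) by (auto simp: finitely_generated_field_def)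
  then consider "algebraic_function_field n TYPE(rat) F"
    | "Factorial_Ring.prime CARD('p)" "algebraic_function_field n TYPE('p) F" by blast
  then show ?thesis
  proof cases
    case 1
    then show ?thesis by (rule function_field_over_rat_decomposes)
  next
    case 2
    have "finite (UNIV :: 'p set)" using 2(1) by (metis card.infinite not_prime_0)
    then have "n \<noteq> 0" using 2(2) assms(2) function_field_no_variables_finite by metis
    then have "function_field TYPE('p) F"
      using 2(2) unfolding function_field_def by (intro exI[of _ n]) simp
    then show ?thesis by (rule function_field_decomposes)
  qed
qed

lemma global_field_decomposes:
  assumes "global_field TYPE('p::field) F"
  shows "\<not> indecomposable (Multiplicative_Group.mult_of F)"
  using assms number_field_decomposes function_field_decomposes
  unfolding global_field_def function_field_def by blast


section \<open>Finite extensions of the p-adic numbers\<close>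

context
  fixes p :: nat assumes p: "Factorial_Ring.prime p"
begin

lemma p_gt_1: "real p > 1"
  using p prime_gt_1_nat by force

lemma padic_norm_0: "padic_norm p 0 = 0"
  by (simp add: padic_norm_def)

lemma padic_norm_nonneg: "padic_norm p x \<ge> 0"
  by (simp add: padic_norm_eq)

lemma padic_norm_pos: "x \<noteq> 0 \<Longrightarrow> padic_norm p x > 0"
  using p_gt_1 by (simp add: padic_norm_eq)

lemma padic_norm_mult: "padic_norm p (x * y) = padic_norm p x * padic_norm p y"
  using p_gt_1 by (simp add: padic_norm_eq padic_val_mult[OF p] power_int_add[symmetric])

lemma padic_norm_minus: "padic_norm p (- x) = padic_norm p x"
  by (simp add: padic_norm_eq padic_val_minus[OF p])

lemma padic_norm_le_iff:
  assumes "x \<noteq> 0" "y \<noteq> 0"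
  shows "padic_norm p x \<le> padic_norm p y \<longleftrightarrow> padic_val p y \<le> padic_val p x"
proof -
  have "real p powi (- padic_val p x) \<le> real p powi (- padic_val p y) \<longleftrightarrow> padic_val p y \<le> padic_val p x"
    (is "?l \<le> ?r \<longleftrightarrow> _")
  proof
    assume "padic_val p y \<le> padic_val p x"
    then show "?l \<le> ?r" using p_gt_1 by (intro power_int_increasing) simp_all
  next
    assume le: "?l \<le> ?r"
    show "padic_val p y \<le> padic_val p x"
    proof (rule ccontr)
      assume "\<not> padic_val p y \<le> padic_val p x"
      then have "?r < ?l" using p_gt_1 by (intro power_int_strict_increasing) simp_all
      with le show False by simp
    qed
  qed
  then show ?thesis using assms by (simp add: padic_norm_eq)
qed

lemma padic_norm_add: "padic_norm p (x + y) \<le> max (padic_norm p x) (padic_norm p y)"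
proof (cases "x = 0 \<or> y = 0 \<or> x + y = 0")
  case True
  then show ?thesis using padic_norm_nonneg[of x] padic_norm_nonneg[of y] by (auto simp: padic_norm_0 max_def)
next
  case False
  then have "padic_val p x \<le> padic_val p (x + y) \<or> padic_val p y \<le> padic_val p (x + y)"
    using padic_val_add[OF p, of x y] by (auto simp: min_def split: if_splits)
  then show ?thesis using False by (auto simp: padic_norm_le_iff[symmetric] le_max_iff_disj)
qed

lemma padic_norm_add_less: "padic_norm p x < e \<Longrightarrow> padic_norm p y < e \<Longrightarrow> padic_norm p (x + y) < e"
  using padic_norm_add[of x y] by simp

text \<open>
  The ultrametric inequality makes the valuation locally constant away from zero. This is why it is
  eventually constant along a Cauchy sequence that is not null, and why it then depends only
  on the coset modulo null sequences.
\<close>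
lemma padic_val_isosceles:
  assumes "padic_norm p (x - y) < padic_norm p y"
  shows "x \<noteq> 0" "y \<noteq> 0" "padic_val p x = padic_val p y"
proof -
  show y: "y \<noteq> 0" using assms padic_norm_nonneg[of "x - y"] by (auto simp: padic_norm_0)
  show x: "x \<noteq> 0" using assms padic_norm_minus[of y] by auto
  have "padic_norm p x \<le> max (padic_norm p (x - y)) (padic_norm p y)"
    using padic_norm_add[of "x - y" y] by simp
  moreover have "padic_norm p y \<le> max (padic_norm p (x - y)) (padic_norm p x)"
    using padic_norm_add[of "- (x - y)" x] padic_norm_minus[of "x - y"] by simp
  ultimately have "padic_norm p x \<le> padic_norm p y" "padic_norm p y \<le> padic_norm p x"
    using assms by auto
  then show "padic_val p x = padic_val p y" using x y by (simp add: padic_norm_le_iff)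
qed

lemma padic_null_iff: "a \<in> padic_null p \<longleftrightarrow> (\<forall>e>0. \<forall>\<^sub>F n in sequentially. padic_norm p (a n) < e)"
  by (simp add: padic_null_def tendsto_iff padic_norm_nonneg)

lemma padic_cauchy_const: "padic_cauchy p (\<lambda>n. c)"
  by (simp add: padic_cauchy_def padic_norm_0)

lemma padic_cauchy_minus: "padic_cauchy p a \<Longrightarrow> padic_cauchy p (\<lambda>n. - a n)"
  unfolding padic_cauchy_def using padic_norm_minus
  by (metis minus_diff_minus)

lemma padic_cauchy_add:
  assumes "padic_cauchy p a" "padic_cauchy p b" shows "padic_cauchy p (\<lambda>n. a n + b n)"
  unfolding padic_cauchy_def
proof (intro allI impI)
  fix e :: real assume "e > 0"
  then obtain N M where N: "\<forall>m\<ge>N. \<forall>n\<ge>N. padic_norm p (a m - a n) < e"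
    and M: "\<forall>m\<ge>M. \<forall>n\<ge>M. padic_norm p (b m - b n) < e"
    using assms unfolding padic_cauchy_def by metis
  have "padic_norm p (a m + b m - (a n + b n)) < e" if "m \<ge> max N M" "n \<ge> max N M" for m n
    using padic_norm_add_less[of "a m - a n" e "b m - b n"] N M that by (simp add: algebra_simps)
  then show "\<exists>N. \<forall>m\<ge>N. \<forall>n\<ge>N. padic_norm p (a m + b m - (a n + b n)) < e" by blast
qed

lemma padic_cauchy_bounded:
  assumes "padic_cauchy p a" obtains B where "B > 0" "\<forall>\<^sub>F n in sequentially. padic_norm p (a n) < B"
proof -
  obtain N where N: "\<forall>m\<ge>N. \<forall>n\<ge>N. padic_norm p (a m - a n) < 1"
    using assms[unfolded padic_cauchy_def, rule_format, of 1] by auto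
  let ?B = "padic_norm p (a N) + 1"
  have bound: "padic_norm p (a n) < ?B" if "n \<ge> N" for n
  proof -
    have "padic_norm p (a n - a N) < ?B" 
      using N[rule_format, of n N] that padic_norm_nonneg[of "a N"] by linarith
    then show ?thesis using padic_norm_add_less[of "a n - a N" ?B "a N"] by simp
  qed
  show thesis
  proof (rule that[of ?B])
    show "?B > 0" using padic_norm_nonneg[of "a N"] by simp
    show "\<forall>\<^sub>F n in sequentially. padic_norm p (a n) < ?B"
      using bound by (rule eventually_sequentiallyI)
  qed
qed

lemma padic_norm_mult_less:
  assumes "padic_norm p x < B" "padic_norm p y < e / B" "B > 0"
  shows "padic_norm p (x * y) < e"
proof -
  have "padic_norm p x * padic_norm p y < B * (e / B)"
    using assms padic_norm_nonneg by (intro mult_strict_mono') auto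
  then show ?thesis using assms(3) by (simp add: padic_norm_mult)
qed

lemma padic_cauchy_mult:
  assumes a: "padic_cauchy p a" and b: "padic_cauchy p b" shows "padic_cauchy p (\<lambda>n. a n * b n)"
  unfolding padic_cauchy_def
proof (intro allI impI)
  fix e :: real assume e: "e > 0"
  obtain A where A: "A > 0" "\<forall>\<^sub>F n in sequentially. padic_norm p (a n) < A"
    using a by (rule padic_cauchy_bounded)
  obtain B where B: "B > 0" "\<forall>\<^sub>F n in sequentially. padic_norm p (b n) < B"
    using b by (rule padic_cauchy_bounded)
  have "e / A > 0" "e / B > 0" using e A B by simp_all
  then obtain N M where N: "\<forall>m\<ge>N. \<forall>n\<ge>N. padic_norm p (a m - a n) < e / B"
    and M: "\<forall>m\<ge>M. \<forall>n\<ge>M. padic_norm p (b m - b n) < e / A"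
    using a b unfolding padic_cauchy_def by metis
  obtain K where K: "\<And>n. n \<ge> K \<Longrightarrow> padic_norm p (a n) < A \<and> padic_norm p (b n) < B"
    using eventually_conj[OF A(2) B(2)] by (auto simp: eventually_sequentially)
  let ?L = "max K (max N M)"
  have "padic_norm p (a m * b m - a n * b n) < e" if "m \<ge> ?L" "n \<ge> ?L" for m n
  proof -
    have "padic_norm p (a m * (b m - b n)) < e"
      using K M that A(1) by (intro padic_norm_mult_less[where B = A]) auto
    moreover have "padic_norm p (b n * (a m - a n)) < e"
      using K N that B(1) by (intro padic_norm_mult_less[where B = B]) auto
    ultimately show ?thesis
      using padic_norm_add_less[of "a m * (b m - b n)" e "b n * (a m - a n)"] by (simp add: algebra_simps)
  qed
  then show "\<exists>N. \<forall>m\<ge>N. \<forall>n\<ge>N. padic_norm p (a m * b m - a n * b n) < e" by blast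
qed

lemma padic_null_minus: "a \<in> padic_null p \<Longrightarrow> (\<lambda>n. - a n) \<in> padic_null p"
  by (simp add: padic_null_iff padic_norm_minus)

lemma padic_null_add: "a \<in> padic_null p \<Longrightarrow> b \<in> padic_null p \<Longrightarrow> (\<lambda>n. a n + b n) \<in> padic_null p"
  unfolding padic_null_iff
proof (intro allI impI)
  fix e :: real
  assume "\<forall>e>0. \<forall>\<^sub>F n in sequentially. padic_norm p (a n) < e"
    "\<forall>e>0. \<forall>\<^sub>F n in sequentially. padic_norm p (b n) < e" and e: "e > 0"
  then have "\<forall>\<^sub>F n in sequentially. padic_norm p (a n) < e" "\<forall>\<^sub>F n in sequentially. padic_norm p (b n) < e"
    by simp_all
  then show "\<forall>\<^sub>F n in sequentially. padic_norm p (a n + b n) < e"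
    by eventually_elim (rule padic_norm_add_less)
qed

lemma padic_null_mult: 
  assumes "padic_cauchy p a" "b \<in> padic_null p" shows "(\<lambda>n. a n * b n) \<in> padic_null p"
  unfolding padic_null_iff
proof (intro allI impI)
  fix e :: real assume e: "e > 0"
  obtain A where A: "A > 0" "\<forall>\<^sub>F n in sequentially. padic_norm p (a n) < A"
    using assms(1) by (rule padic_cauchy_bounded)
  have "\<forall>\<^sub>F n in sequentially. padic_norm p (b n) < e / A"
    using assms(2) e A(1) by (simp add: padic_null_iff)
  with A(2) show "\<forall>\<^sub>F n in sequentially. padic_norm p (a n * b n) < e"
    by eventually_elim (rule padic_norm_mult_less[OF _ _ A(1)])
qed

lemma padic_null_imp_cauchy:
  assumes "a \<in> padic_null p" shows "padic_cauchy p a"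
  unfolding padic_cauchy_def
proof (intro allI impI)
  fix e :: real assume e: "e > 0"
  then obtain N where N: "\<And>n. n \<ge> N \<Longrightarrow> padic_norm p (a n) < e"
    using assms by (auto simp: padic_null_iff eventually_sequentially)
  have "padic_norm p (a m - a n) < e" if "m \<ge> N" "n \<ge> N" for m n
    using padic_norm_add_less[of "a m" e "- a n"] N that by (simp add: padic_norm_minus)
  then show "\<exists>N. \<forall>m\<ge>N. \<forall>n\<ge>N. padic_norm p (a m - a n) < e" by blast
qed

lemma padic_cauchy_ring_cring: "cring (padic_cauchy_ring p)"
proof (rule cringI)
  show "abelian_group (padic_cauchy_ring p)"
  proof (rule abelian_groupI)
    fix a assume "a \<in> carrier (padic_cauchy_ring p)"
    then show "\<exists>b\<in>carrier (padic_cauchy_ring p). b \<oplus>\<^bsub>padic_cauchy_ring p\<^esub> a = \<zero>\<^bsub>padic_cauchy_ring p\<^esub>"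
      by (intro bexI[of _ "\<lambda>n. - a n"]) (auto simp: padic_cauchy_ring_def padic_cauchy_minus)
  qed (auto simp: padic_cauchy_ring_def padic_cauchy_add padic_cauchy_const algebra_simps)
  show "comm_monoid (padic_cauchy_ring p)"
    by (rule comm_monoidI) (auto simp: padic_cauchy_ring_def padic_cauchy_mult padic_cauchy_const algebra_simps)
qed (auto simp: padic_cauchy_ring_def algebra_simps)

lemma padic_null_ideal: "ideal (padic_null p) (padic_cauchy_ring p)"
proof -
  interpret R: cring "padic_cauchy_ring p" by (rule padic_cauchy_ring_cring)
  have inv: "\<ominus>\<^bsub>padic_cauchy_ring p\<^esub> a = (\<lambda>n. - a n)" if "padic_cauchy p a" for a
    using that by (intro R.minus_equality) (auto simp: padic_cauchy_ring_def padic_cauchy_minus)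
  show ?thesis
  proof (rule idealI)
    show "ring (padic_cauchy_ring p)" by (rule R.ring_axioms)
    show "subgroup (padic_null p) (add_monoid (padic_cauchy_ring p))"
    proof (rule R.add.subgroupI)
      show "padic_null p \<subseteq> carrier (padic_cauchy_ring p)"
        using padic_null_imp_cauchy by (auto simp: padic_cauchy_ring_def)
      have "(\<lambda>n. 0) \<in> padic_null p" by (simp add: padic_null_iff padic_norm_0)
      then show "padic_null p \<noteq> {}" by blast
    next
      fix a assume "a \<in> padic_null p"
      then show "\<ominus>\<^bsub>padic_cauchy_ring p\<^esub> a \<in> padic_null p"
        by (simp add: inv padic_null_imp_cauchy padic_null_minus)
    next
      fix a b assume "a \<in> padic_null p" "b \<in> padic_null p"
      then show "a \<oplus>\<^bsub>padic_cauchy_ring p\<^esub> b \<in> padic_null p"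
        by (simp add: padic_cauchy_ring_def padic_null_add)
    qed
    fix a b assume "a \<in> padic_null p" "b \<in> carrier (padic_cauchy_ring p)"
    then have "(\<lambda>n. b n * a n) \<in> padic_null p"
      by (intro padic_null_mult) (auto simp: padic_cauchy_ring_def)
    then show "b \<otimes>\<^bsub>padic_cauchy_ring p\<^esub> a \<in> padic_null p" "a \<otimes>\<^bsub>padic_cauchy_ring p\<^esub> b \<in> padic_null p"
      by (simp_all add: padic_cauchy_ring_def mult.commute)
  qed
qed

lemma padic_coset_eq_iff:
  assumes "padic_cauchy p a" "padic_cauchy p b"
  shows "padic_null p +>\<^bsub>padic_cauchy_ring p\<^esub> a = padic_null p +>\<^bsub>padic_cauchy_ring p\<^esub> b
     \<longleftrightarrow> (\<lambda>n. a n - b n) \<in> padic_null p"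
proof -
  interpret R: cring "padic_cauchy_ring p" by (rule padic_cauchy_ring_cring)
  have inv: "\<ominus>\<^bsub>padic_cauchy_ring p\<^esub> b = (\<lambda>n. - b n)"
    using assms(2) by (intro R.minus_equality) (auto simp: padic_cauchy_ring_def padic_cauchy_minus)
  have "a \<ominus>\<^bsub>padic_cauchy_ring p\<^esub> b = (\<lambda>n. a n - b n)"
    unfolding a_minus_def inv by (simp add: padic_cauchy_ring_def)
  then show ?thesis
    using R.quotient_eq_iff_same_a_r_cos[OF padic_null_ideal, of a b] assms
    by (simp add: padic_cauchy_ring_def)
qed

lemma padic_coset_zero_iff:
  assumes "padic_cauchy p a"
  shows "padic_null p +>\<^bsub>padic_cauchy_ring p\<^esub> a = \<zero>\<^bsub>padic_field p\<^esub> \<longleftrightarrow> a \<in> padic_null p"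
proof -
  interpret I: ideal "padic_null p" "padic_cauchy_ring p" by (rule padic_null_ideal)
  have "\<zero>\<^bsub>padic_field p\<^esub> = padic_null p +>\<^bsub>padic_cauchy_ring p\<^esub> (\<lambda>n. 0)"
    using I.a_coset_add_zero[OF I.a_subset] by (simp add: padic_field_def FactRing_def padic_cauchy_ring_def)
  then show ?thesis
    using padic_coset_eq_iff[OF assms padic_cauchy_const[of 0]] by simp
qed

definition eventual_val :: "(nat \<Rightarrow> rat) \<Rightarrow> int" where
  "eventual_val a = (THE v. \<forall>\<^sub>F n in sequentially. a n \<noteq> 0 \<and> padic_val p (a n) = v)"

lemma eventual_val_eqI:
  assumes "\<forall>\<^sub>F n in sequentially. a n \<noteq> 0 \<and> padic_val p (a n) = v"
  shows "eventual_val a = v"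
  unfolding eventual_val_def
proof (rule the_equality)
  fix w assume "\<forall>\<^sub>F n in sequentially. a n \<noteq> 0 \<and> padic_val p (a n) = w"
  with assms have "\<forall>\<^sub>F n::nat in sequentially. w = v" by eventually_elim simp
  then show "w = v" by simp
qed (rule assms)

lemma eventual_val:
  assumes "padic_cauchy p a" "a \<notin> padic_null p"
  shows "\<forall>\<^sub>F n in sequentially. a n \<noteq> 0 \<and> padic_val p (a n) = eventual_val a"
proof -
  obtain e where e: "e > 0" "\<not> (\<forall>\<^sub>F n in sequentially. padic_norm p (a n) < e)"
    using assms(2) by (auto simp: padic_null_iff)
  obtain N where N: "\<forall>m\<ge>N. \<forall>n\<ge>N. padic_norm p (a m - a n) < e"
    using assms(1) e(1) by (auto simp: padic_cauchy_def)
  obtain k where k: "k \<ge> N" "e \<le> padic_norm p (a k)"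
    using e(2) by (force simp: eventually_sequentially)
  have "a n \<noteq> 0 \<and> padic_val p (a n) = padic_val p (a k)" if "n \<ge> N" for n
    using padic_val_isosceles[of "a n" "a k"] N k that by force
  then have ev: "\<forall>\<^sub>F n in sequentially. a n \<noteq> 0 \<and> padic_val p (a n) = padic_val p (a k)"
    by (auto simp: eventually_sequentially)
  then show ?thesis using eventual_val_eqI[OF ev] by simp
qed

lemma padic_extension_decomposes:
  assumes "finite_extension (padic_field p) F"
  shows "\<not> indecomposable (Multiplicative_Group.mult_of F)"
proof -
  interpret I: ideal "padic_null p" "padic_cauchy_ring p" by (rule padic_null_ideal)
  let ?\<epsilon> = "\<lambda>a. padic_null p +>\<^bsub>padic_cauchy_ring p\<^esub> a"
  have hom: "?\<epsilon> \<in> Ring.ring_hom (padic_cauchy_ring p) (padic_field p)"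
    unfolding padic_field_def by (rule I.rcos_ring_hom)
  show ?thesis
  proof (rule finite_extension_decomposes[OF assms, where C = "{a. padic_cauchy p a}" and \<epsilon> = ?\<epsilon>
        and \<nu> = eventual_val and t = "\<lambda>n. of_nat p"])
    show "1 \<in> {a. padic_cauchy p a}" using padic_cauchy_const[of 1] by (simp add: one_fun_def)
    show "- a \<in> {a. padic_cauchy p a}" if "a \<in> {a. padic_cauchy p a}" for a
      using that padic_cauchy_minus by (simp add: fun_Compl_def)
    show "a + b \<in> {a. padic_cauchy p a}" if "a \<in> {a. padic_cauchy p a}" "b \<in> {a. padic_cauchy p a}" for a b
      using that padic_cauchy_add by (simp add: plus_fun_def)
    show "a * b \<in> {a. padic_cauchy p a}" if "a \<in> {a. padic_cauchy p a}" "b \<in> {a. padic_cauchy p a}" for a b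
      using that padic_cauchy_mult by (simp add: times_fun_def)
    show "?\<epsilon> ` {a. padic_cauchy p a} = carrier (padic_field p)"
      by (auto simp: padic_field_def FactRing_def A_RCOSETS_def' padic_cauchy_ring_def)
    show "?\<epsilon> 1 = \<one>\<^bsub>padic_field p\<^esub>"
      by (simp add: padic_field_def FactRing_def padic_cauchy_ring_def one_fun_def)
    fix a b assume ab: "a \<in> {a. padic_cauchy p a}" "b \<in> {a. padic_cauchy p a}"
    show "?\<epsilon> (a + b) = ?\<epsilon> a \<oplus>\<^bsub>padic_field p\<^esub> ?\<epsilon> b"
      using ring_hom_add[OF hom, of a b] ab by (simp add: padic_cauchy_ring_def plus_fun_def)
    show "?\<epsilon> (a * b) = ?\<epsilon> a \<otimes>\<^bsub>padic_field p\<^esub> ?\<epsilon> b"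
      using ring_hom_mult[OF hom, of a b] ab by (simp add: padic_cauchy_ring_def times_fun_def)
    assume "?\<epsilon> a \<noteq> \<zero>\<^bsub>padic_field p\<^esub>"
    then have a: "\<forall>\<^sub>F n in sequentially. a n \<noteq> 0 \<and> padic_val p (a n) = eventual_val a" and a0: "a \<notin> padic_null p"
      using ab padic_coset_zero_iff eventual_val by simp_all
    show "eventual_val (a * b) = eventual_val a + eventual_val b" if "?\<epsilon> b \<noteq> \<zero>\<^bsub>padic_field p\<^esub>"
    proof (rule eventual_val_eqI)
      have "\<forall>\<^sub>F n in sequentially. b n \<noteq> 0 \<and> padic_val p (b n) = eventual_val b"
        using ab that padic_coset_zero_iff eventual_val by simp
      with a show "\<forall>\<^sub>F n in sequentially. (a * b) n \<noteq> 0 \<and> padic_val p ((a * b) n) = eventual_val a + eventual_val b"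
        by eventually_elim (simp add: times_fun_def padic_val_mult[OF p])
    qed
    show "eventual_val a = eventual_val b" if "?\<epsilon> a = ?\<epsilon> b"
    proof (rule eventual_val_eqI)
      have "?\<epsilon> b \<noteq> \<zero>\<^bsub>padic_field p\<^esub>" using that \<open>?\<epsilon> a \<noteq> \<zero>\<^bsub>padic_field p\<^esub>\<close> by simp
      then have b: "\<forall>\<^sub>F n in sequentially. b n \<noteq> 0 \<and> padic_val p (b n) = eventual_val b"
        using ab padic_coset_zero_iff eventual_val by simp
      have "(\<lambda>n. a n - b n) \<in> padic_null p" using that ab padic_coset_eq_iff by simp
      then have "\<forall>\<^sub>F n in sequentially. padic_norm p (a n - b n) < real p powi (- eventual_val b)"
        using p_gt_1 by (simp add: padic_null_iff)
      with b show "\<forall>\<^sub>F n in sequentially. a n \<noteq> 0 \<and> padic_val p (a n) = eventual_val b"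
      proof eventually_elim
        case (elim n)
        then have "padic_norm p (a n - b n) < padic_norm p (b n)" by (simp add: padic_norm_eq)
        then show ?case using padic_val_isosceles[of "a n" "b n"] elim by simp
      qed
    qed
  next
    have p0: "p \<noteq> 0" using p by auto
    show "(\<lambda>n. of_nat p) \<in> {a. padic_cauchy p a}" by (simp add: padic_cauchy_const)
    have "(\<lambda>n. of_nat p) \<notin> padic_null p"
    proof
      assume "(\<lambda>n. of_nat p) \<in> padic_null p"
      moreover have "padic_norm p (of_nat p) > 0" using p0 by (intro padic_norm_pos) simp
      ultimately have "\<forall>\<^sub>F n::nat in sequentially. padic_norm p (of_nat p) < padic_norm p (of_nat p)"
        unfolding padic_null_iff by blast
      then show False by simp
    qed
    then show "?\<epsilon> (\<lambda>n. of_nat p) \<noteq> \<zero>\<^bsub>padic_field p\<^esub>"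
      using padic_coset_zero_iff[OF padic_cauchy_const] by simp
    have "eventual_val (\<lambda>n. of_nat p) = 1"
      using p0 by (intro eventual_val_eqI) (simp add: padic_val_self[OF p])
    then show "eventual_val (\<lambda>n. of_nat p) \<noteq> 0" by simp
  qed
qed

end


section \<open>Discrete valued fields and Hahn series\<close>
lemma discrete_valued_field_decomposes:
  fixes F :: "('a, 'm) ring_scheme"
  assumes "discrete_valued_field F"
  shows "\<not> indecomposable (Multiplicative_Group.mult_of F)"
proof -
  obtain v :: "'a \<Rightarrow> int" where F: "field F"
    and v: "v \<in> hom (Multiplicative_Group.mult_of F) additive_group"
    and surj: "v ` carrier (Multiplicative_Group.mult_of F) = UNIV"
    using assms by (auto simp: discrete_valued_field_def valuation_def)
  have "1 \<in> v ` carrier (Multiplicative_Group.mult_of F)" unfolding surj by simp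
  then obtain s where "1 = v s" "s \<in> carrier (Multiplicative_Group.mult_of F)" by (rule imageE)
  then have s: "s \<in> carrier F - {\<zero>\<^bsub>F\<^esub>}" "v s = 1" by simp_all
  show ?thesis
  proof (rule decomposable_by_int_valued_hom[OF F, of v s])
    show "v (x \<otimes>\<^bsub>F\<^esub> y) = v x + v y"
      if "x \<in> carrier F - {\<zero>\<^bsub>F\<^esub>}" "y \<in> carrier F - {\<zero>\<^bsub>F\<^esub>}" for x y
      using hom_mult[OF v, of x y] that by (simp add: additive_group_def)
  qed (use s in simp_all)
qed

lemma well_ordered_set_finite:
  fixes A :: "'g::linorder set"
  assumes "finite A" shows "well_ordered_set A"
proof -
  let ?r = "{(x, y). x \<in> A \<and> y \<in> A \<and> x \<le> y}"
  have "wf (?r - Id)"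
  proof (rule wfI_min)
    fix x :: 'g and Q assume x: "x \<in> Q"
    show "\<exists>z\<in>Q. \<forall>y. (y, z) \<in> ?r - Id \<longrightarrow> y \<notin> Q"
    proof (cases "Q \<inter> A = {}")
      case True
      then show ?thesis using x by blast
    next
      case False
      have fin: "finite (Q \<inter> A)" using assms by simp
      show ?thesis
      proof (rule bexI[of _ "Min (Q \<inter> A)"])
        show "Min (Q \<inter> A) \<in> Q" using Min_in[OF fin False] by blast
        show "\<forall>y. (y, Min (Q \<inter> A)) \<in> ?r - Id \<longrightarrow> y \<notin> Q"
          using Min_le[OF fin] by fastforce
      qed
    qed
  qed
  then show ?thesis
    unfolding well_ordered_set_def well_order_on_def linear_order_on_def partial_order_on_def preorder_on_def
    by (auto simp: refl_on_def trans_def antisym_def total_on_def)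
qed

lemma well_ordered_set_least:
  assumes "well_ordered_set A" "A \<noteq> {}"
  shows "\<exists>a\<in>A. \<forall>x\<in>A. a \<le> x"
proof -
  let ?r = "{(x, y). x \<in> A \<and> y \<in> A \<and> x \<le> y}"
  have wf: "wf (?r - Id)" using assms(1) by (simp add: well_ordered_set_def well_order_on_def)
  obtain c where c: "c \<in> A" using assms(2) by blast
  obtain a where a: "a \<in> A" "\<forall>y. (y, a) \<in> ?r - Id \<longrightarrow> y \<notin> A"
    using wf[unfolded wf_eq_minimal, rule_format, OF c] by (rule bexE)
  have "a \<le> x" if "x \<in> A" for x
  proof (rule ccontr)
    assume "\<not> a \<le> x"
    then have "x < a" by simp
    then have "(x, a) \<in> ?r - Id" using that a(1) by auto
    then show False using a(2) that by blast
  qed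
  with a(1) show ?thesis by blast
qed

text \<open>
  A relation rather than a function: for a product, whose support is not yet known to be well-ordered, the
  least exponent is verified for a given candidate.
\<close>
definition least_exponent :: "('g::linorder \<Rightarrow> 'k::zero) \<Rightarrow> 'g \<Rightarrow> bool" where
  "least_exponent f g \<longleftrightarrow> f g \<noteq> 0 \<and> (\<forall>x. f x \<noteq> 0 \<longrightarrow> g \<le> x)"

definition hahn_monomial :: "'g \<Rightarrow> 'g \<Rightarrow> 'k::zero_neq_one" where
  "hahn_monomial g = (\<lambda>x. if x = g then 1 else 0)"

definition leading_monomial :: "('g::linorder \<Rightarrow> 'k::zero_neq_one) \<Rightarrow> 'g \<Rightarrow> 'k" where
  "leading_monomial f = hahn_monomial (THE g. least_exponent f g)"

lemma leading_monomial_eq: "least_exponent f g \<Longrightarrow> leading_monomial f = hahn_monomial g"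
proof -
  assume g: "least_exponent f g"
  then have "(THE g. least_exponent f g) = g"
    by (intro the_equality) (auto simp: least_exponent_def intro: antisym)
  then show ?thesis by (simp add: leading_monomial_def)
qed

lemma least_exponent_monomial: "least_exponent (hahn_monomial g) g"
  by (simp add: least_exponent_def hahn_monomial_def)

text \<open>
  At \<open>a + b\<close> the sum defining the product has the single term \<open>f a * h b\<close>, and at smaller exponents it
  is empty.
\<close>
lemma hahn_least_exponent_mult:
  fixes f h :: "'g::linordered_ab_group_add \<Rightarrow> 'k::field"
  assumes "least_exponent f a" "least_exponent h b"
  shows "least_exponent (f \<otimes>\<^bsub>hahn_series\<^esub> h) (a + b)"
  unfolding least_exponent_def
proof (intro conjI allI impI)
  have le: "a + b \<le> g" if "f x \<noteq> 0" "h (g - x) \<noteq> 0" for g x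
  proof -
    have "a \<le> x" "b \<le> g - x" using assms that by (auto simp: least_exponent_def)
    then have "a + b \<le> x + (g - x)" by (rule add_mono)
    then show ?thesis by simp
  qed
  have "{x. f x \<noteq> 0 \<and> h (a + b - x) \<noteq> 0} = {a}"
  proof (intro equalityI subsetI)
    fix x assume "x \<in> {x. f x \<noteq> 0 \<and> h (a + b - x) \<noteq> 0}"
    then have "a \<le> x" "b \<le> a + b - x" using assms by (auto simp: least_exponent_def)
    then have "x = a" by (simp add: le_diff_eq add.commute)
    then show "x \<in> {a}" by simp
  qed (use assms in \<open>simp add: least_exponent_def\<close>)
  then show "(f \<otimes>\<^bsub>hahn_series\<^esub> h) (a + b) \<noteq> 0"
    using assms by (simp add: hahn_series_def least_exponent_def)
  show "a + b \<le> g" if "(f \<otimes>\<^bsub>hahn_series\<^esub> h) g \<noteq> 0" for g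
  proof -
    have "{x. f x \<noteq> 0 \<and> h (g - x) \<noteq> 0} \<noteq> {}"
    proof
      assume "{x. f x \<noteq> 0 \<and> h (g - x) \<noteq> 0} = {}"
      then show False using that by (simp only: hahn_series_def monoid.simps sum.empty) simp
    qed
    then show ?thesis using le by blast
  qed
qed

lemma hahn_monomial_mult:
  fixes a b :: "'g::linordered_ab_group_add"
  shows "hahn_monomial a \<otimes>\<^bsub>hahn_series\<^esub> hahn_monomial b = (hahn_monomial (a + b) :: 'g \<Rightarrow> 'k::field)"
proof
  fix g
  have "{x. hahn_monomial a x \<noteq> (0::'k) \<and> hahn_monomial b (g - x) \<noteq> (0::'k)} = (if g = a + b then {a} else {})"
    by (auto simp: hahn_monomial_def algebra_simps)
  then show "(hahn_monomial a \<otimes>\<^bsub>hahn_series\<^esub> hahn_monomial b) g = (hahn_monomial (a + b) g :: 'k)"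
    by (simp add: hahn_series_def hahn_monomial_def)
qed

text \<open>
  The leading monomial endomorphism moves \<open>1 + x\<^sup>u\<close> for \<open>u \<noteq> 0\<close>, as this is not a
  monomial, and it does not map \<open>x\<^sup>u\<close> to \<open>1\<close>.
\<close>
lemma hahn_series_field_decomposes:
  fixes F :: "('a, 'm) ring_scheme"
  assumes "field F" "hahn_series_field TYPE('k::field) TYPE('g::linordered_ab_group_add) F"
  shows "\<not> indecomposable (Multiplicative_Group.mult_of F)"
proof -
  let ?E = "hahn_series :: ('g \<Rightarrow> 'k) ring"
  interpret F: field F by fact
  obtain u :: 'g and h where u: "u \<noteq> 0" and h: "h \<in> ring_iso F ?E"
    using assms(2) by (auto simp: hahn_series_field_def is_ring_iso_def)
  have carrier_finite: "f \<in> carrier ?E" if "finite {g. f g \<noteq> 0}" for f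
    using that well_ordered_set_finite by (simp add: hahn_series_def)
  have mono: "hahn_monomial g \<in> carrier ?E - {\<zero>\<^bsub>?E\<^esub>}" for g
  proof
    have "{x. hahn_monomial g x \<noteq> (0::'k)} = {g}" by (auto simp: hahn_monomial_def)
    then show "hahn_monomial g \<in> carrier ?E" by (intro carrier_finite) simp
    have "hahn_monomial g g \<noteq> \<zero>\<^bsub>?E\<^esub> g" by (simp add: hahn_monomial_def hahn_series_def)
    then show "hahn_monomial g \<notin> {\<zero>\<^bsub>?E\<^esub>}" by auto
  qed
  have lead: "\<exists>g. least_exponent f g" if "f \<in> carrier ?E - {\<zero>\<^bsub>?E\<^esub>}" for f
  proof -
    have "well_ordered_set {g. f g \<noteq> 0}" "{g. f g \<noteq> 0} \<noteq> {}"
      using that by (auto simp: hahn_series_def)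
    then show ?thesis using well_ordered_set_least unfolding least_exponent_def by blast
  qed
  have h0: "h \<zero>\<^bsub>F\<^esub> = \<zero>\<^bsub>?E\<^esub>"
  proof
    fix g
    have "h (\<zero>\<^bsub>F\<^esub> \<oplus>\<^bsub>F\<^esub> \<zero>\<^bsub>F\<^esub>) = h \<zero>\<^bsub>F\<^esub> \<oplus>\<^bsub>?E\<^esub> h \<zero>\<^bsub>F\<^esub>"
      using h by (intro ring_hom_add[of h F ?E]) (auto simp: ring_iso_def)
    then have "h \<zero>\<^bsub>F\<^esub> = (\<lambda>g. h \<zero>\<^bsub>F\<^esub> g + h \<zero>\<^bsub>F\<^esub> g)" by (simp add: hahn_series_def)
    then have "h \<zero>\<^bsub>F\<^esub> g + h \<zero>\<^bsub>F\<^esub> g = h \<zero>\<^bsub>F\<^esub> g + 0" by (metis add_0_right)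
    then show "h \<zero>\<^bsub>F\<^esub> g = \<zero>\<^bsub>?E\<^esub> g" by (simp only: add_left_cancel) (simp add: hahn_series_def)
  qed
  define b where "b = (\<lambda>g. if g = 0 \<or> g = u then 1 else 0 :: 'k)"
  show ?thesis
  proof (rule decomposable_by_iso_idempotent[OF assms(1) h, where e = leading_monomial
        and a = "hahn_monomial u" and b = b])
    fix x y assume x: "x \<in> carrier ?E - {\<zero>\<^bsub>?E\<^esub>}"
    then obtain g where g: "least_exponent x g" using lead by blast
    show "leading_monomial x \<in> carrier ?E - {\<zero>\<^bsub>?E\<^esub>}"
      unfolding leading_monomial_eq[OF g] by (rule mono)
    show "leading_monomial (leading_monomial x) = leading_monomial x"
      by (simp add: leading_monomial_eq[OF g] leading_monomial_eq[OF least_exponent_monomial])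
    assume "y \<in> carrier ?E - {\<zero>\<^bsub>?E\<^esub>}"
    then obtain g' where g': "least_exponent y g'" using lead by blast
    show "leading_monomial (x \<otimes>\<^bsub>?E\<^esub> y) = leading_monomial x \<otimes>\<^bsub>?E\<^esub> leading_monomial y"
      using leading_monomial_eq[OF hahn_least_exponent_mult[OF g g']]
      by (simp add: leading_monomial_eq[OF g] leading_monomial_eq[OF g'] hahn_monomial_mult)
  next
    show "hahn_monomial u \<in> carrier ?E - {\<zero>\<^bsub>?E\<^esub>}" by (rule mono)
    have "hahn_monomial u u \<noteq> \<one>\<^bsub>?E\<^esub> u" using u by (simp add: hahn_monomial_def hahn_series_def)
    then show "leading_monomial (hahn_monomial u) \<noteq> \<one>\<^bsub>?E\<^esub>"
      unfolding leading_monomial_eq[OF least_exponent_monomial] by metis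
    have "{g. b g \<noteq> 0} = {0, u}" by (auto simp: b_def)
    then have "b \<in> carrier ?E" by (intro carrier_finite) simp
    moreover have "b 0 \<noteq> \<zero>\<^bsub>?E\<^esub> 0" by (simp add: b_def hahn_series_def)
    ultimately show "b \<in> carrier ?E - {\<zero>\<^bsub>?E\<^esub>}" by auto
    show "leading_monomial b \<noteq> b"
    proof
      assume eq: "leading_monomial b = b"
      obtain w where w: "leading_monomial b = hahn_monomial w"
        unfolding leading_monomial_def by blast
      have "hahn_monomial w 0 = (1 :: 'k)" "hahn_monomial w u = (1 :: 'k)"
        unfolding w[symmetric] eq by (simp_all add: b_def)
      then show False using u by (simp add: hahn_monomial_def split: if_splits)
    qed
  qed (rule h0)
qed


section \<open>Local fields\<close>
lemma ring_iso_of_type_zero: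
  assumes "field F" and h: "h \<in> ring_iso F (ring_of_type_algebra :: 'r::field ring)"
  shows "h \<zero>\<^bsub>F\<^esub> = 0"
proof -
  interpret F: field F by fact
  have "h (\<zero>\<^bsub>F\<^esub> \<oplus>\<^bsub>F\<^esub> \<zero>\<^bsub>F\<^esub>) = h \<zero>\<^bsub>F\<^esub> + h \<zero>\<^bsub>F\<^esub>"
    using h ring_hom_add[of h F "ring_of_type_algebra :: 'r ring" "\<zero>\<^bsub>F\<^esub>" "\<zero>\<^bsub>F\<^esub>"]
    unfolding ring_iso_def ring_of_type_algebra_def by auto
  then have "h \<zero>\<^bsub>F\<^esub> + h \<zero>\<^bsub>F\<^esub> = h \<zero>\<^bsub>F\<^esub> + 0" by simp
  then show ?thesis by (simp only: add_left_cancel)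
qed

lemma real_decomposes:
  assumes F: "field F" and h: "h \<in> ring_iso F (ring_of_type_algebra :: real ring)"
  shows "\<not> indecomposable (Multiplicative_Group.mult_of F)"
  by (rule decomposable_by_iso_idempotent[OF F h, where e = abs and a = 2 and b = "-1"])
    (use ring_iso_of_type_zero[OF F h] in \<open>simp_all add: ring_of_type_algebra_def abs_mult\<close>)

lemma complex_decomposes:
  assumes F: "field F" and h: "h \<in> ring_iso F (ring_of_type_algebra :: complex ring)"
  shows "\<not> indecomposable (Multiplicative_Group.mult_of F)"
  by (rule decomposable_by_iso_idempotent[OF F h, where e = "\<lambda>z. of_real (cmod z)" and a = 2 and b = "-1"])
    (use ring_iso_of_type_zero[OF F h] in \<open>simp_all add: ring_of_type_algebra_def norm_mult\<close>)

lemma laurent_series_decomposes: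
  assumes F: "field F" and h: "h \<in> ring_iso F (ring_of_type_algebra :: 'q::field fls ring)"
  shows "\<not> indecomposable (Multiplicative_Group.mult_of F)"
proof -
  interpret F: field F by fact
  have h0: "h \<zero>\<^bsub>F\<^esub> = 0" using F h by (rule ring_iso_of_type_zero)
  have bij: "bij_betw h (carrier F) UNIV" and hom: "h \<in> Ring.ring_hom F ring_of_type_algebra"
    using h by (simp_all add: ring_iso_def ring_of_type_algebra_def)
  have nz: "h x \<noteq> 0" if "x \<in> carrier F - {\<zero>\<^bsub>F\<^esub>}" for x
    using bij that h0 by (metis DiffE F.zero_closed bij_betw_imp_inj_on inj_onD singletonI)
  obtain s where s: "s \<in> carrier F" "h s = fls_X"
    using bij by (metis UNIV_I bij_betw_imp_surj_on imageE)
  show ?thesis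
  proof (rule decomposable_by_int_valued_hom[OF F, of "\<lambda>x. fls_subdegree (h x)" s])
    show "fls_subdegree (h (x \<otimes>\<^bsub>F\<^esub> y)) = fls_subdegree (h x) + fls_subdegree (h y)"
      if "x \<in> carrier F - {\<zero>\<^bsub>F\<^esub>}" "y \<in> carrier F - {\<zero>\<^bsub>F\<^esub>}" for x y
      using that nz ring_hom_mult[OF hom, of x y] by (simp add: ring_of_type_algebra_def)
    have "h s \<noteq> 0" using s(2) by simp
    then show "s \<in> carrier F - {\<zero>\<^bsub>F\<^esub>}" using s(1) h0 by auto
    show "fls_subdegree (h s) \<noteq> 0" using s by simp
  qed
qed

lemma local_field_decomposes:
  assumes "local_field TYPE('q::{field,finite}) F"
  shows "\<not> indecomposable (Multiplicative_Group.mult_of F)"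
proof -
  obtain T where T: "local_topological_field TYPE('q) F T"
    using assms by (auto simp: local_field_def)
  then have F: "field F" by (simp add: local_topological_field_def)
  from T consider h where "h \<in> ring_iso F (ring_of_type_algebra :: complex ring)"
    | h where "h \<in> ring_iso F (ring_of_type_algebra :: real ring)"
    | p where "Factorial_Ring.prime p" "finite_extension (padic_field p) F"
    | h where "h \<in> ring_iso F (ring_of_type_algebra :: 'q fls ring)"
    unfolding local_topological_field_def topological_field_iso_def topological_finite_extension_def
      finite_extension_def by blast
  then show ?thesis
    by cases (use F complex_decomposes real_decomposes padic_extension_decomposes laurent_series_decomposes in blast)+
qed

theorem mainTheorem3:
  fixes F :: "('a, 'm) ring_scheme"
  assumes "field F" and "infinite (carrier F)"
    and "finitely_generated_field TYPE('p::field) F \<or>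
         discrete_valued_field F \<or>
         hahn_series_field TYPE('h::field) TYPE('g::linordered_ab_group_add) F \<or>
         local_field TYPE('q::{field,finite}) F \<or>
         global_field TYPE('p) F \<or>
         function_field TYPE('k::field) F"
  shows "\<not> indecomposable (Multiplicative_Group.mult_of F)"
  using assms(3)
proof (elim disjE)
  assume "finitely_generated_field TYPE('p) F"
  then show ?thesis using assms(2) by (rule finitely_generated_field_decomposes)
next
  assume "hahn_series_field TYPE('h) TYPE('g) F"
  with assms(1) show ?thesis by (rule hahn_series_field_decomposes)
qed (rule discrete_valued_field_decomposes local_field_decomposes global_field_decomposes
    function_field_decomposes, assumption)+

end
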